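(* Let $D$ be a weakly locally finite division ring with center $F$ and let $N$ be a subnormal subgroup of the multiplicative group $D^*$. If $N$ is radical over $F$, then $N\subseteq F$.
   Context: A division ring $D$ is weakly locally finite if for every finite subset $S\subseteq D$, the division subring generated by $S$ is finite dimensional over its own center. A subset $N$ of $D$ is radical over a subring $K$ if for each $x\in N$ there is a positive integer $n(x)$ with $x^{n(x)}\in K$. *)

theory Defs
  imports Main
begin

definition center_of :: "'a::division_ring set \<Rightarrow> 'a set" where
  "center_of K = {z \<in> K. \<forall>y\<in>K. z * y = y * z}"

abbreviation center :: "'a::division_ring set" where
  "center \<equiv> center_of UNIV"

definition division_subring :: "'a::division_ring set \<Rightarrow> bool" where
  "division_subring K \<longleftrightarrow> 0 \<in> K \<and> 1 \<in> K \<and>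
     (\<forall>x\<in>K. \<forall>y\<in>K. x + y \<in> K \<and> x * y \<in> K) \<and>
     (\<forall>x\<in>K. - x \<in> K) \<and> (\<forall>x\<in>K. x \<noteq> 0 \<longrightarrow> inverse x \<in> K)"

definition gen_division_subring :: "'a::division_ring set \<Rightarrow> 'a set" where
  "gen_division_subring S = \<Inter>{K. division_subring K \<and> S \<subseteq> K}"

definition fin_dim_over_center :: "'a::division_ring set \<Rightarrow> bool" where
  "fin_dim_over_center K \<longleftrightarrow> (\<exists>B. finite B \<and> B \<subseteq> K \<and>
     (\<forall>x\<in>K. \<exists>c. (\<forall>b\<in>B. c b \<in> center_of K) \<and> x = (\<Sum>b\<in>B. c b * b)))"

definition weakly_locally_finite :: "'a::division_ring itself \<Rightarrow> bool" where
  "weakly_locally_finite _ \<longleftrightarrow>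
     (\<forall>S::'a set. finite S \<longrightarrow> fin_dim_over_center (gen_division_subring S))"

definition mult_subgroup :: "'a::division_ring set \<Rightarrow> bool" where
  "mult_subgroup N \<longleftrightarrow> N \<subseteq> {x. x \<noteq> 0} \<and> 1 \<in> N \<and>
     (\<forall>x\<in>N. \<forall>y\<in>N. x * y \<in> N) \<and> (\<forall>x\<in>N. inverse x \<in> N)"

definition normal_in :: "'a::division_ring set \<Rightarrow> 'a set \<Rightarrow> bool" where
  "normal_in N H \<longleftrightarrow> mult_subgroup N \<and> mult_subgroup H \<and> N \<subseteq> H \<and>
     (\<forall>h\<in>H. \<forall>x\<in>N. h * x * inverse h \<in> N)"

inductive subnormal :: "'a::division_ring set \<Rightarrow> bool" where
  top: "subnormal {x. x \<noteq> 0}"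
| step: "subnormal H \<Longrightarrow> normal_in N H \<Longrightarrow> subnormal N"

definition radical_over :: "'a::division_ring set \<Rightarrow> 'a set \<Rightarrow> bool" where
  "radical_over N K \<longleftrightarrow> (\<forall>x\<in>N. \<exists>n>0. x ^ n \<in> K)"

end

theory Submission
  imports Defs "HOL-Number_Theory.Residues" "Jordan_Normal_Form.Determinant"
begin

text \<open>
  Let \<open>x \<in> N\<close> and \<open>y \<in> D\<close>. The division subring \<open>K\<close> generated by \<open>x, y\<close> is finite dimensional over
  its center \<open>F\<close>, and it suffices to show that \<open>x\<close> is central in \<open>K\<close>.

  If every nonzero \<open>s \<in> F\<close> satisfies \<open>s\<^sup>-\<^sup>1 \<in> \<int>[s]\<close>, then finite subsets of \<open>F\<close> lie in finite subfields, so
  \<open>x\<close> and \<open>y\<close> lie in a finite division ring and commute by Wedderburn's theorem.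

  Otherwise \<open>F\<close> has a nontrivial valuation ring \<open>R\<close>, and \<open>R\<close>-lattices give \<open>K\<close> a topology. Close to \<open>1\<close>
  there are no torsion elements except \<open>1\<close>: if \<open>z\<close> has prime order \<open>p\<close> then \<open>\<Sum>i<p. z\<^sup>i = 0\<close>, so \<open>p\<close> is
  close to \<open>0\<close>. For \<open>a, x \<in> N\<close> the commutator \<open>z\<close> of \<open>a\<close> and \<open>x\<close> has norm \<open>1\<close> and a power in \<open>F\<close>, so it is
  torsion; hence elements of \<open>N\<close> close to \<open>1\<close> commute with \<open>x\<close>. This property climbs a subnormal chain
  \<open>G \<lhd> H\<close>: if \<open>a \<in> H\<close> is close to \<open>1\<close>, then \<open>z = a x a\<^sup>-\<^sup>1 x\<^sup>-\<^sup>1 \<in> G\<close> is close to \<open>1\<close> and so commutes with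
  \<open>x\<close>; as \<open>x\<^sup>m\<close> is central, \<open>z x = a x a\<^sup>-\<^sup>1\<close> yields \<open>z\<^sup>m = 1\<close> and \<open>z = 1\<close>. At the top of the chain,
  \<open>x\<close> commutes with a neighbourhood of \<open>1\<close> and therefore with \<open>K\<close>.
\<close>

hide_const (open) UnivPoly.coeff UnivPoly.monom

section \<open>Division subrings and torsion elements\<close>

lemma division_subringD:
  assumes "division_subring K"
  shows "0 \<in> K" "1 \<in> K" "x \<in> K \<Longrightarrow> y \<in> K \<Longrightarrow> x + y \<in> K"
    "x \<in> K \<Longrightarrow> y \<in> K \<Longrightarrow> x * y \<in> K" "x \<in> K \<Longrightarrow> - x \<in> K"
    "x \<in> K \<Longrightarrow> inverse x \<in> K" "x \<in> K \<Longrightarrow> y \<in> K \<Longrightarrow> x - y \<in> K"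
    "x \<in> K \<Longrightarrow> x ^ n \<in> K"
proof -
  have *: "0 \<in> K" "1 \<in> K" "\<And>x y. x \<in> K \<Longrightarrow> y \<in> K \<Longrightarrow> x + y \<in> K"
    "\<And>x y. x \<in> K \<Longrightarrow> y \<in> K \<Longrightarrow> x * y \<in> K" "\<And>x. x \<in> K \<Longrightarrow> - x \<in> K"
    using assms by (auto simp: division_subring_def)
  show "0 \<in> K" "1 \<in> K" "x \<in> K \<Longrightarrow> y \<in> K \<Longrightarrow> x + y \<in> K"
    "x \<in> K \<Longrightarrow> y \<in> K \<Longrightarrow> x * y \<in> K" "x \<in> K \<Longrightarrow> - x \<in> K"
    using * by auto
  show "x \<in> K \<Longrightarrow> inverse x \<in> K"
    using assms by (cases "x = 0") (auto simp: division_subring_def)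
  show "x \<in> K \<Longrightarrow> y \<in> K \<Longrightarrow> x - y \<in> K"
    using *(3)[of x "- y"] *(5) by simp
  show "x \<in> K \<Longrightarrow> x ^ n \<in> K"
    by (induction n) (use * in auto)
qed

lemma division_subring_sum:
  assumes "division_subring K" "\<And>i. i \<in> I \<Longrightarrow> f i \<in> K"
  shows "sum f I \<in> K"
  using assms(2)
  by (induction I rule: infinite_finite_induct) (auto intro: division_subringD[OF assms(1)])

lemma division_subring_gen: "division_subring (gen_division_subring S)"
  by (auto simp: division_subring_def gen_division_subring_def)

lemma gen_division_subring_superset: "S \<subseteq> gen_division_subring S"
  by (auto simp: gen_division_subring_def)

lemma commute_inverse:
  fixes x y :: "'a::division_ring"
  assumes "x * y = y * x"
  shows "inverse x * y = y * inverse x"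
proof (cases "x = 0")
  case False
  have "inverse x * (x * y) * inverse x = inverse x * (y * x) * inverse x"
    using assms by simp
  then have "(inverse x * x) * (y * inverse x) = inverse x * y * (x * inverse x)"
    by (simp only: mult.assoc)
  then show ?thesis using False by simp
qed simp

lemma division_subring_centralizer:
  assumes "division_subring K"
  shows "division_subring {x \<in> K. x * a = a * x}"
  using division_subringD[OF assms] commute_inverse[of _ a]
  by (auto simp: division_subring_def algebra_simps) (metis mult.assoc)

lemma division_subring_center_of:
  assumes "division_subring K"
  shows "division_subring (center_of K)"
proof -
  have eq: "center_of K = {x \<in> K. \<forall>a\<in>K. x \<in> {x \<in> K. x * a = a * x}}"
    by (auto simp: center_of_def)
  show ?thesis
    using division_subring_centralizer[OF assms] division_subringD[OF assms]
    unfolding eq division_subring_def by blast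
qed

lemma center_ofD: "z \<in> center_of K \<Longrightarrow> y \<in> K \<Longrightarrow> z * y = y * z"
  by (simp add: center_of_def)

lemma center_of_subset: "center_of K \<subseteq> K"
  by (auto simp: center_of_def)

section \<open>Powers, roots of unity and torsion orders\<close>

lemma conj_power:
  fixes x y :: "'a::division_ring"
  assumes "x \<noteq> 0"
  shows "(x * y * inverse x) ^ n = x * y ^ n * inverse x"
proof (induction n)
  case (Suc n)
  have "(x * y * inverse x) ^ Suc n = x * y * (inverse x * x) * y ^ n * inverse x"
    using Suc by (simp add: mult.assoc)
  then show ?case using assms by (simp add: mult.assoc)
qed (use assms in simp)

lemma power_commute_mult:
  fixes x y :: "'a::monoid_mult"
  assumes "x * y = y * x"
  shows "(x * y) ^ n = x ^ n * y ^ n"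
proof (induction n)
  case (Suc n)
  have "y * x ^ n = x ^ n * y"
    using power_commuting_commutes[of x y n] assms by simp
  then show ?case using Suc by (simp add: mult.assoc) (metis mult.assoc)
qed simp

text \<open>Each passage of \<open>y\<close> past \<open>x\<close> costs one factor
  \<open>q\<close>, which commutes with both.\<close>

lemma power_swap:
  fixes x y q :: "'a::monoid_mult"
  assumes "y * x = q * x * y" "q * x = x * q" "q * y = y * q"
  shows "y * x ^ n = q ^ n * x ^ n * y" "y ^ n * x = q ^ n * x * y ^ n"
proof -
  show "y * x ^ n = q ^ n * x ^ n * y"
  proof (induction n)
    case (Suc n)
    have "y * x ^ Suc n = y * x * x ^ n" by (simp add: mult.assoc)
    also have "\<dots> = q * x * (y * x ^ n)" by (simp add: assms(1) mult.assoc)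
    also have "\<dots> = q * (x * q ^ n) * x ^ n * y" by (simp add: Suc mult.assoc)
    also have "x * q ^ n = q ^ n * x" by (metis assms(2) power_commuting_commutes)
    finally show ?case by (simp add: mult.assoc)
  qed simp
  show "y ^ n * x = q ^ n * x * y ^ n"
  proof (induction n)
    case (Suc n)
    have "y ^ Suc n * x = y * q ^ n * x * y ^ n"
      using Suc by (simp add: mult.assoc)
    also have "y * q ^ n = q ^ n * y"
      by (metis assms(3) power_commuting_commutes)
    also have "q ^ n * y * x * y ^ n = q ^ n * (y * x) * y ^ n" by (simp add: mult.assoc)
    also have "\<dots> = q ^ n * q * x * y * y ^ n" by (simp add: assms(1) mult.assoc)
    finally show ?case by (simp add: mult.assoc power_commutes flip: power_Suc2)
  qed simp
qed

text \<open>Sorting \<open>(x * y) ^ n\<close> moves every \<open>y\<close> past all later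
  \<open>x\<close>, one factor \<open>q\<close> each, \<open>n * (n - 1) / 2\<close> in total. The
  doubled equation avoids division; for odd \<open>n\<close> it makes \<open>k\<close> a multiple of
  \<open>n\<close>, which the proof of Wedderburn's theorem exploits.\<close>

lemma power_mult_swap:
  fixes x y q :: "'a::monoid_mult"
  assumes "y * x = q * x * y" "q * x = x * q" "q * y = y * q"
  shows "\<exists>k. 2 * k = n * (n - 1) \<and> (x * y) ^ n = q ^ k * x ^ n * y ^ n"
proof (induction n)
  case (Suc n)
  then obtain k where k: "2 * k = n * (n - 1)" "(x * y) ^ n = q ^ k * x ^ n * y ^ n" by auto
  have qx: "q ^ n * x ^ n = x ^ n * q ^ n" for n
    by (metis assms(2) power_commuting_commutes)
  have "(x * y) ^ Suc n = q ^ k * x ^ n * (y ^ n * x) * y"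
    using k(2) by (simp add: mult.assoc power_Suc2 del: power_Suc)
  also have "\<dots> = q ^ k * (x ^ n * q ^ n) * x * y ^ n * y"
    by (simp add: power_swap(2)[OF assms] mult.assoc)
  also have "\<dots> = q ^ (k + n) * x ^ Suc n * y ^ Suc n"
    by (simp add: qx[symmetric] power_add power_Suc2 mult.assoc del: power_Suc)
  finally show ?case using k(1)
    by (intro exI[of _ "k + n"]) (cases n; auto simp: algebra_simps)
qed (auto intro: exI[of _ 0])

lemma geometric_sum_root_of_unity:
  fixes z :: "'a::division_ring"
  assumes "z ^ n = 1" "z \<noteq> 1"
  shows "(\<Sum>i<n. z ^ i) = 0"
proof -
  have "(z - 1) * (\<Sum>i<n. z ^ i) = z ^ n - 1"
    by (induction n) (simp_all add: algebra_simps)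
  then show ?thesis using assms by simp
qed

lemma one_plus_power:
  fixes u :: "'a::ring_1"
  shows "(1 + u) ^ n = (\<Sum>k\<le>n. of_nat (n choose k) * u ^ k)"
proof (induction n)
  case (Suc n)
  have "(1 + u) ^ Suc n = (\<Sum>k\<le>n. of_nat (n choose k) * u ^ k)
      + (\<Sum>k\<le>n. of_nat (n choose k) * u ^ Suc k)"
    by (simp add: Suc power_Suc2 distrib_left sum_distrib_right mult.assoc power_commutes
        del: power_Suc)
  also have "(\<Sum>k\<le>n. of_nat (n choose k) * u ^ k)
      = 1 + (\<Sum>k\<le>n. of_nat (n choose Suc k) * u ^ Suc k)"
    using sum.atMost_Suc_shift[of "\<lambda>k. of_nat (n choose k) * u ^ k" n]
    by (simp add: binomial_eq_0)
  finally show ?case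
    by (simp add: sum.atMost_Suc_shift[of _ n] distrib_right sum.distrib add_ac
        del: power_Suc sum.atMost_Suc)
qed simp

text \<open>In characteristic \<open>p\<close> the inner binomial coefficients vanish, so
  \<open>(1 + u) ^ p = 1 + u ^ p\<close> with \<open>u = z - 1\<close>. Hence
  \<open>u ^ p = 0\<close>, and a division ring has no nilpotents except \<open>0\<close>.\<close>

lemma prime_char_power_eq_one:
  fixes z :: "'a::division_ring"
  assumes "prime p" "of_nat p = (0::'a)" "z ^ p = 1"
  shows "z = 1"
proof -
  define u where "u = z - 1"
  have p: "p > 0" using assms(1) prime_gt_0_nat by blast
  have "(1 + u) ^ p = (\<Sum>k\<in>{0,p}. of_nat (p choose k) * u ^ k)"
    unfolding one_plus_power
  proof (rule sum.mono_neutral_right)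
    show "\<forall>i\<in>{..p} - {0, p}. of_nat (p choose i) * u ^ i = 0"
    proof
      fix i assume "i \<in> {..p} - {0, p}"
      then have "p dvd (p choose i)" using assms(1) by (intro dvd_choose_prime) auto
      then show "of_nat (p choose i) * u ^ i = 0" using assms(2) by (auto elim!: dvdE)
    qed
  qed auto
  then have "u ^ p = 0" using p assms(3) by (simp add: u_def)
  then show ?thesis by (simp add: u_def)
qed

text \<open>Pigeonhole: two powers of \<open>x\<close> coincide, and the smaller one
  cancels.\<close>

lemma finite_closed_torsion:
  fixes x :: "'a::division_ring"
  assumes "finite K" "\<And>n. x ^ n \<in> K" "x \<noteq> 0"
  shows "\<exists>n>0. x ^ n = 1"
proof -
  have "\<not> inj (\<lambda>n::nat. x ^ n)"
    using assms(1,2) by (meson finite_subset image_subsetI infinite_UNIV_nat finite_image_iff)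
  then obtain m n :: nat where "x ^ m = x ^ n" "m < n"
    by (metis (mono_tags, lifting) injI linorder_neqE_nat)
  moreover have "x ^ m * x ^ (n - m) = x ^ n" using \<open>m < n\<close> by (simp flip: power_add)
  ultimately have "x ^ m * x ^ (n - m) = x ^ m * 1" by simp
  then show ?thesis using assms(3) \<open>m < n\<close> by (intro exI[of _ "n - m"]) auto
qed

definition torsion_order :: "'a::division_ring \<Rightarrow> nat" where
  "torsion_order a = (LEAST n. n > 0 \<and> a ^ n = 1)"

lemma torsion_order:
  assumes "\<exists>n>0. a ^ n = 1"
  shows "torsion_order a > 0" "a ^ torsion_order a = 1"
    "0 < k \<Longrightarrow> k < torsion_order a \<Longrightarrow> a ^ k \<noteq> 1"
proof -
  show "torsion_order a > 0" "a ^ torsion_order a = 1"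
    using LeastI_ex[OF assms] by (auto simp: torsion_order_def)
  show "0 < k \<Longrightarrow> k < torsion_order a \<Longrightarrow> a ^ k \<noteq> 1"
    using not_less_Least[of k "\<lambda>n. n > 0 \<and> a ^ n = 1"] by (auto simp: torsion_order_def)
qed

lemma of_nat_eq_0_prime:
  assumes "of_nat n = (0::'a::division_ring)" "n > 0"
  obtains p where "prime p" "p dvd n" "of_nat p = (0::'a)"
  using assms
proof (induction n arbitrary: thesis rule: less_induct)
  case (less n)
  have "n \<noteq> 1" using less.prems by auto
  then obtain p where p: "prime p" "p dvd n" using prime_factor_nat by blast
  then obtain m where m: "n = p * m" by auto
  show ?case
  proof (cases "of_nat p = (0::'a)")
    case False
    then have "of_nat m = (0::'a)" using less.prems m by simp
    moreover have "m > 0" "m < n" using less.prems m p prime_gt_1_nat[of p] by auto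
    ultimately show ?thesis using less.IH[of m] less.prems m by (metis dvd_mult)
  qed (use p less.prems in blast)
qed

text \<open>If a prime \<open>p\<close> vanishing in the ring divided the order,
  \<open>a ^ m\<close> with \<open>m\<close> the order divided by \<open>p\<close> would be a
  \<open>p\<close>-th root of unity, hence \<open>1\<close>, against minimality of the order. This
  permits cancelling the order after summing over the powers of \<open>a\<close>.\<close>

lemma of_nat_torsion_order:
  fixes a :: "'a::division_ring"
  assumes "\<exists>n>0. a ^ n = 1"
  shows "of_nat (torsion_order a) \<noteq> (0::'a)"
proof
  assume "of_nat (torsion_order a) = (0::'a)"
  then obtain p where p: "prime p" "p dvd torsion_order a" "of_nat p = (0::'a)"
    using of_nat_eq_0_prime torsion_order(1)[OF assms] by blast
  then obtain m where m: "torsion_order a = m * p" by (metis dvdE mult.commute)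
  then have "(a ^ m) ^ p = 1" using torsion_order(2)[OF assms] by (simp add: power_mult)
  then have "a ^ m = 1" using prime_char_power_eq_one p by blast
  moreover have "0 < m" "m < torsion_order a"
    using m torsion_order(1)[OF assms] prime_gt_1_nat[OF p(1)] by auto
  ultimately show False using torsion_order(3)[OF assms] by blast
qed

section \<open>Wedderburn's little theorem\<close>

text \<open>The elements \<open>\<Sum>k<n. a\<^sup>-\<^sup>i\<^sup>k x a\<^sup>k\<close> are the components of \<open>n x\<close> in the eigenspaces of
  right multiplication by \<open>a\<close>; one with an eigenvalue other than \<open>a\<close> is nonzero.\<close>

lemma torsion_conj_power:
  fixes a x :: "'a::division_ring"
  assumes tor: "\<exists>n>0. a ^ n = 1" and nc: "x * a \<noteq> a * x"
    and K: "division_subring K" "a \<in> K" "x \<in> K"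
  obtains y i where "y \<in> K" "y \<noteq> 0" "y * a = a ^ i * y" "a ^ i \<noteq> a"
proof -
  define n where "n = torsion_order a"
  note n = torsion_order[OF tor, folded n_def]
  define b where "b = inverse a"
  have a0: "a \<noteq> 0" using nc by auto
  have ab: "a * b = 1" "b * a = 1" using a0 by (simp_all add: b_def)
  have abi: "a ^ i * b ^ i = 1" for i
    using power_commute_mult[of a b i] ab by simp
  have bn: "b ^ n = 1" using abi[of n] n by simp
  define c where "c i = (\<Sum>k<n. b ^ (i * k) * x * a ^ k)" for i
  have cK: "c i \<in> K" for i
    unfolding c_def b_def by (intro division_subring_sum division_subringD[OF K(1)] K)
  have eig: "c i * a = a ^ i * c i" for i
  proof -
    let ?g = "\<lambda>k. b ^ (i * k) * x * a ^ k"
    have "c i * a = (\<Sum>k<n. a ^ i * ?g (Suc k))"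
      unfolding c_def sum_distrib_right
    proof (rule sum.cong)
      fix k
      have "a ^ i * ?g (Suc k) = (a ^ i * b ^ i) * b ^ (i * k) * x * a ^ Suc k"
        by (simp add: power_add mult.assoc)
      then show "?g k * a = a ^ i * ?g (Suc k)"
        by (simp add: abi mult.assoc power_commutes)
    qed simp
    also have "\<dots> = a ^ i * (\<Sum>k<n. ?g (Suc k))" by (simp add: sum_distrib_left)
    \<comment> \<open>The summands at \<open>0\<close> and \<open>n\<close> agree, so a shift of the
      index does not change the sum.\<close>
    also have "(\<Sum>k<n. ?g (Suc k)) = (\<Sum>k<n. ?g k)"
    proof -
      have "?g n = ?g 0" using n bn by (simp add: mult.commute[of i n] power_mult)
      then show ?thesis
        using sum.lessThan_Suc_shift[of ?g n] by (simp add: add.commute)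
    qed
    finally show ?thesis by (simp add: c_def)
  qed
  have "(\<Sum>i<n. c i) = (\<Sum>k<n. (\<Sum>i<n. (b ^ k) ^ i) * x * a ^ k)"
    unfolding c_def by (subst sum.swap)
      (simp add: sum_distrib_right mult.commute[of _ "_::nat"] flip: power_mult)
  \<comment> \<open>For \<open>0 < k < n\<close> the element \<open>b ^ k\<close> is an
    \<open>n\<close>-th root of unity other than \<open>1\<close>, so its geometric sum
    vanishes.\<close>
  also have "\<dots> = (\<Sum>k<n. if k = 0 then of_nat n * x else 0)"
  proof (rule sum.cong)
    fix k assume k: "k \<in> {..<n}"
    have "(\<Sum>i<n. (b ^ k) ^ i) = 0" if "k \<noteq> 0"
    proof (rule geometric_sum_root_of_unity)
      show "(b ^ k) ^ n = 1" by (metis bn mult.commute power_mult power_one)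
      show "b ^ k \<noteq> 1" using abi[of k] n(3)[of k] k that by auto
    qed
    then show "(\<Sum>i<n. (b ^ k) ^ i) * x * a ^ k = (if k = 0 then of_nat n * x else 0)" by simp
  qed simp
  also have "\<dots> = of_nat n * x" using n(1) by simp
  finally have sum: "(\<Sum>i<n. c i) = of_nat n * x" .
  \<comment> \<open>If every nonzero \<open>c i\<close> had \<open>a ^ i = a\<close>, then
    \<open>of_nat n * x\<close> would commute with \<open>a\<close>; cancelling \<open>n\<close>
    contradicts the choice of \<open>x\<close>.\<close>
  have "\<exists>i. c i \<noteq> 0 \<and> a ^ i \<noteq> a"
  proof (rule ccontr)
    assume "\<not> ?thesis"
    then have "c i * a = a * c i" for i using eig[of i] by (cases "c i = 0") auto
    then have "(\<Sum>i<n. c i) * a = a * (\<Sum>i<n. c i)"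
      by (simp add: sum_distrib_left sum_distrib_right)
    then have "of_nat n * (x * a) = a * of_nat n * x"
      using sum by (simp add: mult.assoc)
    then have "of_nat n * (x * a) = of_nat n * (a * x)"
      by (simp only: mult_of_nat_commute[symmetric] mult.assoc)
    then show False using nc of_nat_torsion_order[OF tor] by (simp add: n_def)
  qed
  then show ?thesis using that cK eig by blast
qed

text \<open>The sums \<open>d j\<close> below are the components of \<open>of_nat r\<close> in the
  eigenspaces of left multiplication by \<open>c\<close> with eigenvalue \<open>l ^ j\<close>. They
  add up to something nonzero, so some \<open>d j\<close> is nonzero and cancels from
  \<open>c * d j = l ^ j * d j\<close>.\<close>

lemma root_of_unity_in_powers:
  fixes c l :: "'a::division_ring"
  assumes "prime r" "of_nat r \<noteq> (0::'a)" "l ^ r = 1" "l \<noteq> 1" "c * l = l * c" "c ^ r = 1"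
  shows "\<exists>j<r. c = l ^ j"
proof -
  define m where "m = inverse l"
  have l0: "l \<noteq> 0" using assms(1,3) prime_gt_0_nat[of r] by (auto simp: power_0_left)
  have lm: "l ^ j * m ^ j = 1" for j
    using power_commute_mult[of l m j] l0 by (simp add: m_def)
  have mr: "m ^ r = 1" using lm[of r] assms by simp
  have mc: "m * c = c * m" using commute_inverse[of l c] assms(5) by (simp add: m_def)
  have mkc: "m ^ k * c = c * m ^ k" for k using mc by (metis power_commuting_commutes)
  define d where "d j = (\<Sum>k<r. m ^ (j * k) * c ^ k)" for j
  have eig: "c * d j = l ^ j * d j" for j
  proof -
    let ?g = "\<lambda>k. m ^ (j * k) * c ^ k"
    have "c * d j = (\<Sum>k<r. l ^ j * ?g (Suc k))"
      unfolding d_def sum_distrib_left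
    proof (rule sum.cong)
      fix k
      have "l ^ j * ?g (Suc k) = (l ^ j * m ^ j) * m ^ (j * k) * c * c ^ k"
        by (simp add: power_add mult.assoc)
      also have "\<dots> = c * m ^ (j * k) * c ^ k" by (simp add: lm mkc)
      finally show "c * ?g k = l ^ j * ?g (Suc k)" by (simp add: mult.assoc)
    qed simp
    also have "\<dots> = l ^ j * (\<Sum>k<r. ?g (Suc k))" by (simp add: sum_distrib_left)
    also have "(\<Sum>k<r. ?g (Suc k)) = (\<Sum>k<r. ?g k)"
    proof -
      have "?g r = ?g 0" using assms(6) mr by (simp add: mult.commute[of j r] power_mult)
      then show ?thesis
        using sum.lessThan_Suc_shift[of ?g r] by (simp add: add.commute)
    qed
    finally show ?thesis by (simp add: d_def)
  qed
  have "(\<Sum>j<r. d j) = (\<Sum>k<r. (\<Sum>j<r. (m ^ k) ^ j) * c ^ k)"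
    unfolding d_def by (subst sum.swap)
      (simp add: sum_distrib_right mult.commute[of _ "_::nat"] flip: power_mult)
  also have "\<dots> = (\<Sum>k<r. if k = 0 then of_nat r else 0)"
  proof (rule sum.cong)
    fix k assume k: "k \<in> {..<r}"
    have "(\<Sum>j<r. (m ^ k) ^ j) = 0" if "k \<noteq> 0"
    proof (rule geometric_sum_root_of_unity)
      show "(m ^ k) ^ r = 1" by (metis mr mult.commute power_mult power_one)
      show "m ^ k \<noteq> 1"
      proof
        \<comment> \<open>Since \<open>k\<close> is prime to \<open>r\<close>, Bezout turns
          \<open>l ^ k = 1\<close> and \<open>l ^ r = 1\<close> into \<open>l = 1\<close>.\<close>
        assume "m ^ k = 1"
        then have lk: "l ^ k = 1" using lm[of k] by simp
        have "coprime k r"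
          using assms(1) k that
          by (metis coprime_commute gr0I lessThan_iff nat_dvd_not_less prime_imp_coprime)
        then obtain u v where "k * u = r * v + 1"
          using coprime_bezout_strong[of k r] prime_gt_1_nat[OF assms(1)] by auto
        then have "l ^ (k * u) = l ^ (r * v + 1)" by simp
        then have "l = 1" by (simp only: power_mult power_add assms(3) lk) simp
        then show False using assms by simp
      qed
    qed
    then show "(\<Sum>j<r. (m ^ k) ^ j) * c ^ k = (if k = 0 then of_nat r else 0)" by simp
  qed simp
  also have "\<dots> = of_nat r" using prime_gt_0_nat[OF assms(1)] by simp
  finally have "(\<Sum>j<r. d j) \<noteq> 0" using assms(2) by simp
  then obtain j where "j < r" "d j \<noteq> 0" by (meson lessThan_iff sum.neutral)
  then show ?thesis using eig[of j] by auto
qed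

text \<open>Squaring is at most two-to-one on nonzero elements, so the squares including
  \<open>0\<close> fill more than half of \<open>Z\<close>. Hence the sets of all
  \<open>\<alpha> * q\<close> and of all \<open>1 - \<beta> * q\<close>, with \<open>q\<close> a
  square, must meet.\<close>

lemma finite_field_quadratic_form:
  fixes Z :: "'a::division_ring set"
  assumes fin: "finite Z" and Z: "division_subring Z" and comm: "\<And>x y. x \<in> Z \<Longrightarrow> y \<in> Z \<Longrightarrow> x * y = y * x"
    and "\<alpha> \<in> Z" "\<alpha> \<noteq> 0" "\<beta> \<in> Z" "\<beta> \<noteq> 0"
  obtains s t where "s \<in> Z" "t \<in> Z" "\<alpha> * s^2 + \<beta> * t^2 = 1"
proof -
  note ZD = division_subringD[OF Z]
  define Q where "Q = (\<lambda>s. s^2) ` (Z - {0})"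
  have finQ: "finite Q" "0 \<notin> Q" "Q \<subseteq> Z" using fin ZD by (auto simp: Q_def)
  have fib: "card {s \<in> Z - {0}. s^2 = q} \<le> 2" if q: "q \<in> Q" for q
  proof -
    obtain t where t: "t \<in> Z" "q = t^2" using q by (auto simp: Q_def)
    have "{s \<in> Z - {0}. s^2 = q} \<subseteq> {t, -t}"
    proof
      fix s assume s: "s \<in> {s \<in> Z - {0}. s^2 = q}"
      then have "(s - t) * (s + t) = 0"
        using comm[of s t] t by (simp add: algebra_simps power2_eq_square)
      then show "s \<in> {t, -t}" by (auto simp: eq_neg_iff_add_eq_0)
    qed
    then have "card {s \<in> Z - {0}. s^2 = q} \<le> card {t, -t}" by (intro card_mono) auto
    also have "\<dots> \<le> 2" by (simp add: card_insert_if)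
    finally show ?thesis .
  qed
  have "card (Z - {0}) \<le> card (\<Union>q\<in>Q. {s \<in> Z - {0}. s^2 = q})"
    using finQ fin by (intro card_mono) (auto simp: Q_def)
  also have "\<dots> \<le> (\<Sum>q\<in>Q. card {s \<in> Z - {0}. s^2 = q})" by (rule card_UN_le[OF finQ(1)])
  also have "\<dots> \<le> (\<Sum>q\<in>Q. 2)" by (intro sum_mono fib)
  finally have "card (Z - {0}) \<le> 2 * card Q" by simp
  moreover have "card Z = card (Z - {0}) + 1"
    using card_Suc_Diff1[OF fin ZD(1)] by simp
  ultimately have cQ: "card Z < 2 * card (insert 0 Q)" using finQ by simp
  define S T where "S = (\<lambda>q. \<alpha> * q) ` insert 0 Q" and "T = (\<lambda>q. 1 - \<beta> * q) ` insert 0 Q"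
  have cS: "card S = card (insert 0 Q)"
    unfolding S_def using assms by (intro card_image inj_onI) simp
  have cT: "card T = card (insert 0 Q)"
    unfolding T_def using assms by (intro card_image inj_onI) simp
  have "S \<union> T \<subseteq> Z" using ZD finQ assms by (auto simp: S_def T_def)
  then have "card (S \<union> T) \<le> card Z" using fin by (rule card_mono[rotated])
  then have "S \<inter> T \<noteq> {}"
    using cS cT cQ finQ card_Un_disjoint[of S T] by (auto simp: S_def T_def)
  then obtain e where "e \<in> S" "e \<in> T" by blast
  then obtain q q' where q: "q \<in> insert 0 Q" "q' \<in> insert 0 Q" "\<alpha> * q = 1 - \<beta> * q'"
    unfolding S_def T_def by (elim imageE) metis
  have "\<exists>s\<in>Z. q = s^2" if "q \<in> insert 0 Q" for q
    using that ZD(1) by (auto simp: Q_def intro: bexI[of _ 0])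
  then obtain s t where "s \<in> Z" "t \<in> Z" "q = s^2" "q' = t^2" using q by meson
  then show ?thesis using that[of s t] q(3) by (simp add: algebra_simps)
qed

text \<open>In a minimal counterexample with center \<open>Z\<close>, take a noncentral \<open>a\<close> with \<open>a\<^sup>r \<in> Z\<close> and \<open>r\<close> least
  possible. A conjugation \<open>a \<mapsto> a\<^sup>i\<close> leads to \<open>b\<close> with \<open>b a = \<lambda> a b\<close>, where \<open>\<lambda> \<in> Z\<close> is a primitive
  \<open>r\<close>-th root of unity. For \<open>r = 2\<close>, some \<open>s a + t b\<close> has square \<open>1\<close>. For odd \<open>r\<close>, the \<open>r\<close>-th power is
  a homomorphism from the group generated by \<open>Z\<^sup>*, a, b\<close> (inside \<open>E\<close> below) to \<open>Z\<^sup>*\<close> with kernel the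
  powers of \<open>\<lambda>\<close>, and the group is too large for this.\<close>

theorem finite_division_subring_commutative:
  fixes K :: "'a::division_ring set"
  assumes "finite K" "division_subring K" "x \<in> K" "y \<in> K"
  shows "x * y = y * x"
  using assms
proof (induction "card K" arbitrary: K x y rule: less_induct)
  case less
  note fin = less.prems(1) and KS = less.prems(2)
  note KD = division_subringD[OF KS]
  define Z where "Z = center_of K"
  have ZS: "division_subring Z" unfolding Z_def by (rule division_subring_center_of[OF KS])
  note ZD = division_subringD[OF ZS]
  have ZK: "Z \<subseteq> K" by (simp add: Z_def center_of_subset)
  have Zc: "z * u = u * z" if "z \<in> Z" "u \<in> K" for z u
    using that by (auto simp: Z_def center_of_def)
  have ZI: "z \<in> Z" if "z \<in> K" "\<And>u. u \<in> K \<Longrightarrow> z * u = u * z" for z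
    using that by (auto simp: Z_def center_of_def)
  \<comment> \<open>By induction the centralizer of a noncentral element is commutative, being a
    smaller division subring.\<close>
  have comm: "u * v = v * u"
    if c: "c \<in> K" "c \<notin> Z" and uv: "u \<in> K" "v \<in> K" "u * c = c * u" "v * c = c * v" for c u v
  proof -
    let ?C = "{x \<in> K. x * c = c * x}"
    obtain t where "t \<in> K" "c * t \<noteq> t * c" using c ZI[of c] by blast
    then have "?C \<subset> K" by (intro psubsetI) (auto dest: sym)
    then have "card ?C < card K" using fin by (rule psubset_card_mono[rotated])
    moreover have "finite ?C" using fin by simp
    ultimately show ?thesis
      using less.hyps[of ?C u v] division_subring_centralizer[OF KS] uv by auto
  qed
  show ?case
  proof (rule ccontr)
    assume "x * y \<noteq> y * x"
    then have "x \<notin> Z" using Zc[of x y] less.prems by auto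
    define P where "P r \<longleftrightarrow> r > 0 \<and> (\<exists>a\<in>K. a \<notin> Z \<and> a ^ r \<in> Z)" for r
    define r where "r = (LEAST r. P r)"
    have tor: "\<exists>n>0. u ^ n = 1" if "u \<in> K" "u \<noteq> 0" for u
      using finite_closed_torsion[OF fin KD(8)[OF that(1)] that(2)] .
    have "\<exists>r. P r"
    proof -
      have "x \<noteq> 0" using \<open>x \<notin> Z\<close> ZD(1) by auto
      then obtain n where "n > 0" "x ^ n = 1" using tor less.prems by blast
      then have "P n" using \<open>x \<notin> Z\<close> less.prems ZD(2) by (auto simp: P_def intro!: bexI[of _ x])
      then show ?thesis ..
    qed
    then have "P r" unfolding r_def by (rule LeastI_ex)
    then obtain a where r0: "r > 0" and a: "a \<in> K" "a \<notin> Z" "a ^ r \<in> Z" by (auto simp: P_def)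
    have min: "u ^ k \<notin> Z" if "u \<in> K" "u \<notin> Z" "0 < k" "k < r" for u k
      using not_less_Least[of k P] that by (auto simp: P_def r_def)
    have r1: "r \<noteq> 1" using a by (auto)
    \<comment> \<open>For a proper factorization \<open>r = m * n\<close>, minimality makes first
      \<open>a ^ m\<close> and then \<open>(a ^ m) ^ n = a ^ r\<close> noncentral.\<close>
    have pr: "prime r"
      unfolding prime_nat_iff
    proof (intro conjI allI impI)
      show "1 < r" using r0 r1 by simp
      fix m assume "m dvd r"
      then obtain n where mn: "r = m * n" by auto
      have False if "m \<noteq> 1" "m \<noteq> r"
      proof -
        have "0 < m" "0 < n" using mn r0 by auto
        moreover have "n \<noteq> 1" using mn that by auto
        ultimately have *: "m < r" "n < r" using mn that by auto
        then have "a ^ m \<notin> Z" "a ^ m \<in> K" using min[of a m] a KD(8) \<open>0 < m\<close> by auto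
        then have "(a ^ m) ^ n \<notin> Z" using min[of "a ^ m" n] \<open>0 < n\<close> * by auto
        then show False using a mn by (simp add: power_mult)
      qed
      then show "m = 1 \<or> m = r" by auto
    qed
    have a0: "a \<noteq> 0" using a ZD(1) by auto
    obtain v where v: "v \<in> K" "v * a \<noteq> a * v" using ZI[of a] a by metis
    obtain y i where y: "y \<in> K" "y \<noteq> 0" "y * a = a ^ i * y" "a ^ i \<noteq> a"
      using torsion_conj_power[OF tor[OF a(1) a0] v(2) KS a(1) v(1)] by blast
    have yZ: "y \<notin> Z" using Zc[of y a] y a by auto
    have yam: "y * a ^ m = a ^ (i * m) * y" for m
    proof (induction m)
      case (Suc m)
      have "y * a ^ Suc m = (y * a) * a ^ m" by (simp add: mult.assoc)
      also have "\<dots> = a ^ i * (y * a ^ m)" by (simp add: y mult.assoc)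
      finally show ?case by (simp add: Suc power_add mult.assoc)
    qed simp
    have yka: "y ^ k * a = a ^ (i ^ k) * y ^ k" for k
    proof (induction k)
      case (Suc k)
      have "y ^ Suc k * a = y * (y ^ k * a)" by (simp add: mult.assoc)
      also have "\<dots> = (y * a ^ (i ^ k)) * y ^ k" by (simp add: Suc mult.assoc)
      finally show ?case by (simp add: yam mult.assoc)
    qed simp
    \<comment> \<open>Otherwise \<open>a ^ i\<close> is central and
      \<open>y * a = a ^ i * y = y * a ^ i\<close> gives \<open>a = a ^ i\<close>.\<close>
    have "\<not> r dvd i"
    proof
      assume "r dvd i"
      then obtain m where "i = r * m" by auto
      then have aiZ: "a ^ i \<in> Z" using a ZD by (simp add: power_mult)
      then have "y * a = y * a ^ i" using y Zc[of "a ^ i" y] by simp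
      then show False using y by simp
    qed
    \<comment> \<open>By Fermat, passing from \<open>y\<close> to \<open>b = y ^ (r - 1)\<close>
      turns the exponent \<open>i\<close> into \<open>1 + r * u\<close>, so \<open>b\<close>
      conjugates \<open>a\<close> to \<open>l * a\<close> with the central element
      \<open>l = (a ^ r) ^ u\<close>.\<close>
    then have "i ^ (r - 1) mod r = 1"
      using fermat_theorem[OF pr] prime_gt_1_nat[OF pr] by (simp add: cong_def)
    then obtain u where u: "i ^ (r - 1) = 1 + r * u"
      by (metis add.commute mod_mult_div_eq)
    define l where "l = (a ^ r) ^ u"
    define b where "b = y ^ (r - 1)"
    have lZ: "l \<in> Z" using a ZD by (simp add: l_def)
    have lK: "l \<in> K" using lZ ZK by auto
    have b: "b \<in> K" "b \<noteq> 0" using y KD by (simp_all add: b_def)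
    have ba: "b * a = l * a * b"
      using yka[of "r - 1"] u Zc[OF lZ a(1)]
      by (simp add: b_def l_def power_mult)
    have bZ: "b \<notin> Z" unfolding b_def using min[of y "r - 1"] y yZ pr prime_gt_1_nat[OF pr] by simp
    \<comment> \<open>Both \<open>a\<close> and \<open>y\<close> would commute with the noncentral
      \<open>b\<close>, hence with each other.\<close>
    have l1: "l \<noteq> 1"
    proof
      assume "l = 1"
      then have "a * b = b * a" using ba by simp
      moreover have "y * b = b * y" by (simp add: b_def power_commutes)
      ultimately have "y * a = a * y" using comm[OF b(1) bZ, of y a] y a by simp
      then have "a ^ i * y = a * y" using y by simp
      then show False using y by simp
    qed
    have ab: "a * b \<noteq> b * a"
    proof
      assume "a * b = b * a"
      then have "1 * (b * a) = l * (b * a)" using ba by (simp add: mult.assoc)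
      then show False using l1 a0 b by simp
    qed
    \<comment> \<open>A noncentral \<open>c\<close> would have a commutative centralizer containing
      \<open>a\<close> and \<open>b\<close>.\<close>
    have inZ: "c \<in> Z" if "c \<in> K" "c * a = a * c" "c * b = b * c" for c
      using comm[of c a b] that a b ab by metis
    \<comment> \<open>Moving \<open>c\<close> past \<open>d ^ r\<close> costs \<open>s ^ r\<close>,
      but \<open>d ^ r\<close> is central.\<close>
    have root1: "s ^ r = 1" if "s \<in> Z" "c \<in> K" "c \<noteq> 0" "d \<in> K" "d \<noteq> 0" "d ^ r \<in> Z" "c * d = s * d * c"
      for s c d
    proof -
      have "c * d ^ r = s ^ r * d ^ r * c"
        using power_swap(1)[of c d s r] that Zc[of s] by simp
      then have "1 * (d ^ r * c) = s ^ r * (d ^ r * c)"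
        using Zc[of "d ^ r" c] that by (simp add: mult.assoc)
      then show ?thesis using that by simp
    qed
    have lr: "l ^ r = 1" using root1[OF lZ b a(1) a0 a(3)] ba by simp
    have "b ^ r * a = a * b ^ r"
      using power_swap(2)[of b a l r] ba Zc[OF lZ] a b lr by simp
    then have br: "b ^ r \<in> Z"
      using inZ[of "b ^ r"] b KD by (simp add: power_commutes)
    \<comment> \<open>In characteristic \<open>r\<close> there is no nontrivial \<open>r\<close>-th
      root of unity, but \<open>l\<close> is one.\<close>
    have rne: "of_nat r \<noteq> (0::'a)"
      using prime_char_power_eq_one[OF pr _ lr] l1 by blast
    show False
    proof (cases "r = 2")
      case True
      have "(l - 1) * (l + 1) = 0"
        using lr True by (simp add: algebra_simps power2_eq_square)
      then have l: "l = -1" using l1 by (simp add: eq_neg_iff_add_eq_0)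
      have "a ^ 2 \<in> Z" "b ^ 2 \<in> Z" using a br True by auto
      then obtain s t where st: "s \<in> Z" "t \<in> Z" "a^2 * s^2 + b^2 * t^2 = 1"
        using finite_field_quadratic_form[OF finite_subset[OF ZK fin] ZS, of "a^2" "b^2"] Zc ZK a0 b(2)
        by (metis power_not_zero subsetD)
      have sa: "a * s = s * a" "b * s = s * b" "a * t = t * a" "b * t = t * b" "t * s = s * t"
        using st Zc a b ZK by auto
      \<comment> \<open>As \<open>l = -1\<close>, the elements \<open>a\<close> and \<open>b\<close>
        anticommute, so the cross terms of \<open>g * g\<close> cancel and the choice of
        \<open>s\<close> and \<open>t\<close> gives \<open>g * g = 1\<close>.\<close>
      define g where "g = s * a + t * b"
      have "(s * a) * (s * a) = a^2 * s^2" "(t * b) * (t * b) = b^2 * t^2"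
        using power_commute_mult[of a s 2] power_commute_mult[of b t 2] sa
        by (simp_all add: power2_eq_square[of "_ * _"])
      moreover have "(s * a) * (t * b) + (t * b) * (s * a) = 0"
      proof -
        have "(s * a) * (t * b) = s * (a * t) * b" "(t * b) * (s * a) = t * (b * s) * a"
          by (simp_all only: mult.assoc)
        then have "(s * a) * (t * b) = s * t * (a * b)" "(t * b) * (s * a) = s * t * (b * a)"
          by (simp_all only: sa) (simp_all only: sa(5) flip: mult.assoc)
        then show ?thesis using ba l by simp
      qed
      ultimately have "g * g = 1" using st(3)
        unfolding g_def distrib_left distrib_right by (simp add: algebra_simps)
      \<comment> \<open>Thus \<open>g\<close> is \<open>1\<close> or \<open>-1\<close> and commutes
        with \<open>a\<close>, which forces \<open>t = 0\<close>; then \<open>s * a = g\<close> puts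
        \<open>a\<close> into \<open>Z\<close>.\<close>
      then have "(g - 1) * (g + 1) = 0" by (simp add: algebra_simps)
      then have g: "g = 1 \<or> g = -1" by (auto simp: eq_neg_iff_add_eq_0)
      then have "g * a = a * g" by auto
      moreover have "g * a = s * a * a + t * (b * a)"
        by (simp add: g_def distrib_right mult.assoc)
      moreover have "a * g = s * a * a + t * (a * b)"
        by (simp add: g_def distrib_left sa flip: mult.assoc)
      ultimately have "t * (b * a) = t * (a * b)" by simp
      then have "t = 0" using ab by auto
      then have sa1: "s * a = 1 \<or> s * a = -1" using g by (simp add: g_def)
      then have "s \<noteq> 0" by auto
      then have "a = inverse s * (s * a)" by (simp add: mult.assoc[symmetric])
      then have "a \<in> Z" using sa1 st ZD by metis
      then show False using a by simp
    next
      case False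
      then have odd: "odd r" using pr prime_odd_nat prime_ge_2_nat[OF pr] by simp
      \<comment> \<open>\<open>E\<close> collects the elements that commute with \<open>a\<close>
        and \<open>b\<close> up to factors in \<open>Z\<close>. Fibres of the \<open>r\<close>-th
        power on \<open>E\<close> have at most \<open>r\<close> elements, so
        \<open>card E \<le> card (Z - {0}) * r\<close>; the multiples of powers of \<open>a\<close>
        already attain this number, and \<open>b\<close> is one element more.\<close>
      define E where "E = {c \<in> K. c \<noteq> 0 \<and> (\<exists>s\<in>Z. c * a = s * a * c) \<and> (\<exists>s\<in>Z. c * b = s * b * c)}"
      have finE: "finite E" using fin by (simp add: E_def)
      have EZ: "c ^ r \<in> Z - {0}" if cE: "c \<in> E" for c
      proof -
        obtain s t where c: "c \<in> K" "c \<noteq> 0" and s: "s \<in> Z" "c * a = s * a * c"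
          and t: "t \<in> Z" "c * b = t * b * c" using cE by (auto simp: E_def)
        have "s ^ r = 1" "t ^ r = 1"
          using root1[OF s(1) c a(1) a0 a(3) s(2)] root1[OF t(1) c b br t(2)] by auto
        moreover have "c ^ r * a = s ^ r * a * c ^ r" "c ^ r * b = t ^ r * b * c ^ r"
          using power_swap(2)[of c a s r] power_swap(2)[of c b t r] Zc s t c a b by auto
        ultimately show ?thesis using inZ[of "c ^ r"] c KD by auto
      qed
      have fib: "card {c \<in> E. c ^ r = z} \<le> r" for z
      proof (cases "{c \<in> E. c ^ r = z} = {}")
        case False
        then obtain c where cE: "c \<in> E" "c ^ r = z" by auto
        then have c: "c \<in> K" "c \<noteq> 0" by (auto simp: E_def)
        have "{c \<in> E. c ^ r = z} \<subseteq> (\<lambda>j. c * l ^ j) ` {..<r}"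
        proof
          fix d assume "d \<in> {c \<in> E. c ^ r = z}"
          then have dE: "d \<in> E" "d ^ r = z" by auto
          then have d: "d \<in> K" "d \<noteq> 0" by (auto simp: E_def)
          define w where "w = inverse c * d"
          have w: "w \<in> K" "w \<noteq> 0" "d = c * w"
            using c d KD by (auto simp: w_def mult.assoc[symmetric])
          define q where "q = d * c * inverse (c * d)"
          have qK: "q \<in> K" using c d KD by (simp add: q_def)
          \<comment> \<open>Moving \<open>c * d\<close> or \<open>d * c\<close> past
            \<open>e\<close> costs the same central factor \<open>t * s\<close>, so their quotient
            \<open>q\<close> commutes with \<open>e\<close>.\<close>
          have com: "q * e = e * q" if e: "e \<in> K"
            and ex: "\<exists>s\<in>Z. c * e = s * e * c" "\<exists>s\<in>Z. d * e = s * e * d" for e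
          proof -
            obtain s t where s: "s \<in> Z" "c * e = s * e * c" and t: "t \<in> Z" "d * e = t * e * d"
              using ex by blast
            have sK: "s \<in> K" "t \<in> K" using s t ZK by auto
            have "c * d * e = c * t * e * d" using t by (simp add: mult.assoc)
            also have "\<dots> = t * (c * e) * d" 
              by (simp only: Zc[OF t(1) c(1), symmetric] mult.assoc[symmetric])
            also have "\<dots> = t * s * e * (c * d)" using s by (simp add: mult.assoc)
            finally have 1: "c * d * e = t * s * e * (c * d)" .
            have "d * c * e = d * s * e * c" using s by (simp add: mult.assoc)
            also have "\<dots> = s * (d * e) * c" 
              by (simp only: Zc[OF s(1) d(1), symmetric] mult.assoc[symmetric])
            also have "\<dots> = s * (t * e * d) * c" by (simp only: t(2))
            also have "\<dots> = t * s * e * (d * c)"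
              by (simp only: Zc[OF s(1) sK(2)] mult.assoc[symmetric])
            finally have 2: "d * c * e = t * s * e * (d * c)" .
            have qcd: "q * (c * d) = d * c" using c d by (simp add: q_def mult.assoc)
            define p where "p = t * s"
            have pZ: "p \<in> Z" using s t ZD(4) by (simp add: p_def)
            note 1 = 1[folded p_def] and 2 = 2[folded p_def]
            have "q * e * p * (c * d) = q * (p * e * (c * d))"
              by (simp only: Zc[OF pZ e] mult.assoc)
            also have "\<dots> = q * (c * d) * e" by (simp only: 1[symmetric]) (simp only: mult.assoc)
            also have "\<dots> = p * e * (d * c)" using qcd 2 by simp
            also have "\<dots> = e * (p * q) * (c * d)"
              by (simp only: Zc[OF pZ e] qcd mult.assoc)
            also have "\<dots> = e * (q * p) * (c * d)" by (simp only: Zc[OF pZ qK])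
            finally have 3: "q * e * (p * (c * d)) = e * q * (p * (c * d))"
              by (simp only: mult.assoc)
            have "e \<noteq> 0 \<Longrightarrow> p \<noteq> 0" using s t c d by (auto simp: p_def)
            then show ?thesis using 3 c d by (cases "e = 0") auto
          qed
          have qZ: "q \<in> Z"
            using inZ[OF qK] com[of a] com[of b] a b cE dE by (auto simp: E_def)
          have dc: "d * c = q * c * d" using c d by (simp add: q_def mult.assoc)
          have qr: "q ^ r = 1" using root1[OF qZ d c] EZ[OF cE(1)] dc by simp
          have "c * (w * c) = c * (q * c * w)"
            using dc w(3) Zc[OF qZ c(1)] by (metis mult.assoc)
          then have wc: "w * c = q * c * w" using c by simp
          obtain k where k: "2 * k = r * (r - 1)" "(c * w) ^ r = q ^ k * c ^ r * w ^ r"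
            using power_mult_swap[of w c q r] wc Zc[OF qZ] c w by auto
          \<comment> \<open>Here the oddness of \<open>r\<close> enters:
            \<open>k = r * (r - 1) / 2\<close> is a multiple of \<open>r\<close>, so
            \<open>q ^ k = 1\<close> and \<open>d ^ r = c ^ r * w ^ r\<close>. Hence
            \<open>w ^ r = 1\<close>.\<close>
          obtain m where "r - 1 = 2 * m" using odd by (auto elim!: oddE)
          then have "k = r * m" using k(1) by simp
          then have "q ^ k = 1" by (simp add: power_mult qr)
          then have "z * 1 = z * w ^ r" using k(2) w(3) cE dE by simp
          then have "w ^ r = 1" using EZ[OF cE(1)] cE by simp
          then obtain j where "j < r" "w = l ^ j"
            using root_of_unity_in_powers[OF pr rne lr l1, of w] Zc[OF lZ w(1)] by auto
          then show "d \<in> (\<lambda>j. c * l ^ j) ` {..<r}" using w(3) by auto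
        qed
        then have "card {c \<in> E. c ^ r = z} \<le> card ((\<lambda>j. c * l ^ j) ` {..<r})"
          by (intro card_mono) auto
        also have "\<dots> \<le> r" using card_image_le[of "{..<r}"] by fastforce
        finally show ?thesis .
      next
        case True
        then show ?thesis by (simp only: card.empty)
      qed
      have finZ: "finite (Z - {0})" using finite_subset[OF ZK fin] by simp
      have "card E \<le> card (\<Union>z\<in>Z - {0}. {c \<in> E. c ^ r = z})"
        using EZ finE finZ by (intro card_mono) auto
      also have "\<dots> \<le> (\<Sum>z\<in>Z - {0}. card {c \<in> E. c ^ r = z})" by (rule card_UN_le[OF finZ])
      also have "\<dots> \<le> (\<Sum>z\<in>Z - {0}. r)" by (intro sum_mono fib)
      finally have upper: "card E \<le> card (Z - {0}) * r" by simp
      \<comment> \<open>These products are distinct: an equality would make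
        \<open>a ^ (j - i)\<close> central for some \<open>0 < j - i < r\<close>, against the
        minimality of \<open>r\<close>.\<close>
      define X where "X = (\<lambda>(z, i). z * a ^ i) ` ((Z - {0}) \<times> {..<r})"
      have "inj_on (\<lambda>(z, i). z * a ^ i) ((Z - {0}) \<times> {..<r})"
      proof -
        have eq: "i = j"
          if "i \<le> j" "j < r" "z \<in> Z" "z \<noteq> 0" "z' \<in> Z" "z' \<noteq> 0" "z * a ^ i = z' * a ^ j" for z z' i j
        proof (rule ccontr)
          assume "i \<noteq> j"
          have "z * a ^ i = z' * a ^ (j - i) * a ^ i"
            using that by (simp add: mult.assoc flip: power_add)
          then have "z = z' * a ^ (j - i)" using a0 by simp
          then have "a ^ (j - i) = inverse z' * z" using that by (simp add: mult.assoc[symmetric])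
          then have "a ^ (j - i) \<in> Z" using ZD that by simp
          then show False using min[of a "j - i"] a \<open>i \<noteq> j\<close> that by auto
        qed
        show ?thesis
        proof (rule inj_onI)
          fix p p' assume p: "p \<in> (Z - {0}) \<times> {..<r}" "p' \<in> (Z - {0}) \<times> {..<r}"
            "(case p of (z, i) \<Rightarrow> z * a ^ i) = (case p' of (z, i) \<Rightarrow> z * a ^ i)"
          obtain z i z' j where zi: "p = (z, i)" "p' = (z', j)" by fastforce
          have *: "z \<in> Z" "z \<noteq> 0" "z' \<in> Z" "z' \<noteq> 0" "i < r" "j < r" "z * a ^ i = z' * a ^ j"
            using p by (auto simp: zi)
          have "i = j" using eq[of i j z z'] eq[of j i z' z] * by (cases "i \<le> j") auto
          then show "p = p'" using * a0 by (simp add: zi)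
        qed
      qed
      then have "card X = card (Z - {0}) * r" by (simp add: X_def card_image card_cartesian_product)
      moreover have Xa: "x * a = a * x" if xX: "x \<in> X" for x
      proof -
        obtain z i where "x = z * a ^ i" "z \<in> Z" using xX by (auto simp: X_def)
        then show ?thesis using Zc[of z a] a by (metis mult.assoc power_commutes)
      qed
      then have "b \<notin> X" using ab by auto
      moreover have "insert b X \<subseteq> E"
      proof -
        have "b \<in> E" using b ba lZ ZD(2) by (auto simp: E_def)
        moreover have "x \<in> E" if xX: "x \<in> X" for x
        proof -
          obtain z i where x: "x = z * a ^ i" "z \<in> Z" "z \<noteq> 0" using xX by (auto simp: X_def)
          have zK: "z \<in> K" using x ZK by auto
          have ili: "inverse l ^ i \<in> Z" using lZ ZD by simp
          have l0: "l \<noteq> 0" using lr r0 by (auto simp: power_0_left)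
          have bai: "b * a ^ i = l ^ i * a ^ i * b"
            using power_swap(1)[of b a l i] ba Zc[OF lZ] a b by simp
          have "inverse l ^ i * l ^ i = 1"
            using power_commute_mult[of "inverse l" l i] l0 by simp
          then have "a ^ i * b = inverse l ^ i * (b * a ^ i)"
            unfolding bai by (simp add: mult.assoc[symmetric])
          then have "x * b = z * inverse l ^ i * b * a ^ i" by (simp add: x mult.assoc)
          also have "z * inverse l ^ i * b = inverse l ^ i * b * z"
            using Zc[of z "inverse l ^ i * b"] x ili ZK KD b by (simp add: mult.assoc subsetD)
          finally have "x * b = inverse l ^ i * b * x" by (simp add: x mult.assoc)
          moreover have "x * a = 1 * a * x" using Xa[OF xX] by simp
          moreover have "x \<in> K" "x \<noteq> 0" using x zK a a0 KD by auto
          ultimately show ?thesis using ili ZD(2) by (auto simp: E_def)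
        qed
        ultimately show ?thesis by auto
      qed
      then have "card (insert b X) \<le> card E" using finE by (rule card_mono[rotated])
      ultimately show False using upper finite_subset[OF \<open>insert b X \<subseteq> E\<close> finE] by simp
    qed
  qed
qed

section \<open>Subrings of fields and valuation rings\<close>

definition ring_closed :: "'f::field set \<Rightarrow> bool" where
  "ring_closed R \<longleftrightarrow> 1 \<in> R \<and> (\<forall>x\<in>R. \<forall>y\<in>R. x - y \<in> R \<and> x * y \<in> R)"

lemma ring_closedD:
  assumes "ring_closed R"
  shows "0 \<in> R" "1 \<in> R" "x \<in> R \<Longrightarrow> - x \<in> R" "x \<in> R \<Longrightarrow> y \<in> R \<Longrightarrow> x + y \<in> R"
    "x \<in> R \<Longrightarrow> y \<in> R \<Longrightarrow> x - y \<in> R" "x \<in> R \<Longrightarrow> y \<in> R \<Longrightarrow> x * y \<in> R"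
    "x \<in> R \<Longrightarrow> x ^ n \<in> R" "(\<And>i. i \<in> I \<Longrightarrow> f i \<in> R) \<Longrightarrow> sum f I \<in> R"
proof -
  have one: "1 \<in> R" and diff: "\<And>x y. x \<in> R \<Longrightarrow> y \<in> R \<Longrightarrow> x - y \<in> R"
    and mult: "\<And>x y. x \<in> R \<Longrightarrow> y \<in> R \<Longrightarrow> x * y \<in> R"
    using assms by (auto simp: ring_closed_def)
  have zero: "0 \<in> R" using diff[OF one one] by simp
  have neg: "- x \<in> R" if "x \<in> R" for x using diff[OF zero that] by simp
  have add: "x + y \<in> R" if "x \<in> R" "y \<in> R" for x y using diff[OF that(1) neg[OF that(2)]] by simp
  show "0 \<in> R" "1 \<in> R" "x \<in> R \<Longrightarrow> - x \<in> R" "x \<in> R \<Longrightarrow> y \<in> R \<Longrightarrow> x + y \<in> R"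
    "x \<in> R \<Longrightarrow> y \<in> R \<Longrightarrow> x - y \<in> R" "x \<in> R \<Longrightarrow> y \<in> R \<Longrightarrow> x * y \<in> R"
    by (fact zero one neg add diff mult)+
  show "x \<in> R \<Longrightarrow> x ^ n \<in> R" by (induction n) (simp_all add: one mult)
  show "(\<And>i. i \<in> I \<Longrightarrow> f i \<in> R) \<Longrightarrow> sum f I \<in> R"
    by (induction I rule: infinite_finite_induct) (simp_all add: zero add)
qed

lemma ring_closed_range_of_int: "ring_closed (range (of_int :: int \<Rightarrow> 'f::field))"
  unfolding ring_closed_def
  by (auto simp flip: of_int_diff of_int_mult) (metis of_int_1 rangeI)

lemma of_int_in_ring_closed:
  assumes "ring_closed R"
  shows "of_int k \<in> R"
proof -
  have "of_nat n \<in> R" for n by (induction n) (simp_all add: ring_closedD[OF assms])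
  then show ?thesis by (cases k) (simp_all add: ring_closedD[OF assms] del: of_nat_Suc)
qed

definition adjoin :: "'f::field set \<Rightarrow> 'f \<Rightarrow> 'f set" where
  "adjoin R u = {poly g u | g. \<forall>i. coeff g i \<in> R}"

lemma adjoin_superset:
  assumes "ring_closed R"
  shows "R \<subseteq> adjoin R u" "u \<in> adjoin R u"
proof -
  note RD = ring_closedD[OF assms]
  show "R \<subseteq> adjoin R u"
  proof
    fix x assume "x \<in> R"
    then have "\<forall>i. coeff [:x:] i \<in> R" using RD(1) by (simp add: coeff_pCons split: nat.split)
    moreover have "x = poly [:x:] u" by simp
    ultimately show "x \<in> adjoin R u" unfolding adjoin_def by blast
  qed
  have "\<forall>i. coeff [:0, 1:] i \<in> R" using RD(1,2) by (simp add: coeff_pCons split: nat.split)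
  moreover have "u = poly [:0, 1:] u" by simp
  ultimately show "u \<in> adjoin R u" unfolding adjoin_def by blast
qed

lemma ring_closed_adjoin:
  assumes "ring_closed R"
  shows "ring_closed (adjoin R u)"
proof -
  note RD = ring_closedD[OF assms]
  have "poly g u - poly h u \<in> adjoin R u" "poly g u * poly h u \<in> adjoin R u"
    if "\<forall>i. coeff g i \<in> R" "\<forall>i. coeff h i \<in> R" for g h
  proof -
    have "\<forall>i. coeff (g - h) i \<in> R" using RD(5) that by simp
    moreover have "poly g u - poly h u = poly (g - h) u" by simp
    ultimately show "poly g u - poly h u \<in> adjoin R u" unfolding adjoin_def by blast
    have "\<forall>i. coeff (g * h) i \<in> R" unfolding coeff_mult using that by (intro allI RD(8) RD(6)) auto
    moreover have "poly g u * poly h u = poly (g * h) u" by simp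
    ultimately show "poly g u * poly h u \<in> adjoin R u" unfolding adjoin_def by blast
  qed
  moreover have "1 \<in> adjoin R u" using adjoin_superset(1)[OF assms] RD(2) by auto
  ultimately show ?thesis unfolding ring_closed_def by (auto simp: adjoin_def)
qed

section \<open>Existence of valuation rings\<close>

definition valuation_ring :: "'f::field set \<Rightarrow> bool" where
  "valuation_ring R \<longleftrightarrow> ring_closed R \<and> (\<forall>x. x \<in> R \<or> inverse x \<in> R)"

text \<open>A subring that is maximal among those containing \<open>s\<close> but not its inverse is a valuation ring.\<close>

lemma valuation_ring_exists:
  fixes s :: "'f::field"
  assumes s: "inverse s \<notin> adjoin (range of_int) s"
  obtains R where "valuation_ring R" "s \<in> R" "inverse s \<notin> R"
proof -
  define A where "A = {R. ring_closed R \<and> s \<in> R \<and> inverse s \<notin> R}"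
  have s0: "s \<noteq> 0"
    using s ring_closedD(1)[OF ring_closed_adjoin[OF ring_closed_range_of_int], of s] by auto
  have "\<exists>M\<in>A. \<forall>X\<in>A. M \<subseteq> X \<longrightarrow> X = M"
  proof (rule subset_Zorn_nonempty)
    have "adjoin (range of_int) s \<in> A"
      using s ring_closed_adjoin adjoin_superset ring_closed_range_of_int by (auto simp: A_def)
    then show "A \<noteq> {}" by blast
    fix C assume C: "C \<noteq> {}" "subset.chain A C"
    have CA: "ring_closed R" "s \<in> R" "inverse s \<notin> R" if "R \<in> C" for R
      using that C(2) by (auto simp: A_def subset_chain_def)
    have "x - y \<in> \<Union>C \<and> x * y \<in> \<Union>C" if xy: "x \<in> \<Union>C" "y \<in> \<Union>C" for x y
    proof -
      obtain R1 R2 where R: "R1 \<in> C" "x \<in> R1" "R2 \<in> C" "y \<in> R2" using xy by auto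
      then have "R1 \<subseteq> R2 \<or> R2 \<subseteq> R1" using C(2) by (auto simp: subset_chain_def)
      then obtain R where "R \<in> C" "x \<in> R" "y \<in> R" using R by auto
      then show ?thesis using ring_closedD(5,6)[OF CA(1)] by blast
    qed
    moreover have "1 \<in> \<Union>C" using C(1) ring_closedD(2)[OF CA(1)] by auto
    ultimately have "ring_closed (\<Union>C)" by (simp add: ring_closed_def)
    then show "\<Union>C \<in> A" using CA C(1) by (auto simp: A_def)
  qed
  then obtain R where R: "ring_closed R" "s \<in> R" "inverse s \<notin> R"
    and maxR: "\<And>X. X \<in> A \<Longrightarrow> R \<subseteq> X \<Longrightarrow> X = R" by (auto simp: A_def)
  note RD = ring_closedD[OF R(1)]
  have adj: "inverse s \<in> adjoin R u" if "u \<notin> R" for u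
  proof (rule ccontr)
    assume "inverse s \<notin> adjoin R u"
    then have "adjoin R u \<in> A"
      using ring_closed_adjoin[OF R(1)] adjoin_superset[OF R(1)] R(2) by (auto simp: A_def)
    then show False using maxR adjoin_superset[OF R(1)] that by metis
  qed
  \<comment> \<open>Otherwise maximality gives \<open>inverse s = poly g (inverse t)\<close> for
    \<open>t = 1 - s * r\<close>. Multiplying by \<open>t ^ n\<close> with \<open>n\<close> the
    degree of \<open>g\<close> clears denominators, and \<open>t ^ n\<close> is \<open>1\<close>
    modulo multiples of \<open>s\<close>, so \<open>inverse s\<close> would lie in
    \<open>R\<close>.\<close>
  have unit: "inverse (1 - s * r) \<in> R" if r: "r \<in> R" for r
  proof (rule ccontr)
    define t where "t = 1 - s * r"
    assume "inverse (1 - s * r) \<notin> R"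
    then obtain g where g: "\<forall>i. coeff g i \<in> R" "inverse s = poly g (inverse t)"
      using adj by (auto simp: adjoin_def t_def)
    have tR: "t \<in> R" using RD R(2) r by (simp add: t_def)
    have t0: "t \<noteq> 0"
    proof
      assume "t = 0"
      then have "inverse s = r" using s0 by (simp add: t_def field_simps)
      then show False using r R(3) by simp
    qed
    have tn: "\<exists>r'\<in>R. t ^ n = 1 - s * r'" for n
    proof (induction n)
      case (Suc n)
      then obtain r' where r': "r' \<in> R" "t ^ n = 1 - s * r'" by auto
      have "t ^ Suc n = t * (1 - s * r')" by (simp add: r')
      also have "\<dots> = 1 - s * (r + r' - s * r * r')" by (simp add: t_def algebra_simps)
      finally show ?case using RD(4,5,6) R(2) r r'(1)
        by (intro bexI[of _ "r + r' - s * r * r'"]) simp_all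
    qed (use RD in \<open>auto intro: bexI[of _ 0]\<close>)
    define n where "n = degree g"
    have "inverse s * t ^ n = (\<Sum>i\<le>n. coeff g i * t ^ (n - i))"
      unfolding g(2) poly_altdef n_def sum_distrib_right
    proof (rule sum.cong)
      fix i assume "i \<in> {..degree g}"
      then have "t ^ degree g = t ^ i * t ^ (degree g - i)" by (simp flip: power_add)
      then show "coeff g i * inverse t ^ i * t ^ degree g = coeff g i * t ^ (degree g - i)"
        using t0 by (simp add: field_simps)
    qed simp
    also have "\<dots> \<in> R" using g(1) tR by (intro RD(8) RD(6) RD(7)) auto
    finally have "inverse s * t ^ n \<in> R" .
    moreover obtain r' where r': "r' \<in> R" "t ^ n = 1 - s * r'" using tn by auto
    ultimately have "inverse s * t ^ n + r' \<in> R" using RD(4) by blast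
    moreover have "inverse s * t ^ n + r' = inverse s" using r'(2) s0 by (simp add: field_simps)
    ultimately show False using R(3) by simp
  qed
  \<comment> \<open>This is the statement that \<open>inverse s\<close> is a polynomial in
    \<open>u\<close> of degree at most \<open>n\<close> over \<open>R\<close>, multiplied by
    \<open>s\<close>.\<close>
  define rel where "rel u n \<longleftrightarrow> (\<exists>c. (\<forall>i. c i \<in> R) \<and> 1 = (\<Sum>i\<le>n. s * c i * u ^ i))" for u n
  have rel_ex: "\<exists>n. rel u n" if u: "u \<notin> R" for u
  proof -
    obtain g where "\<forall>i. coeff g i \<in> R" "inverse s = poly g u"
      using adj[OF u] by (auto simp: adjoin_def)
    moreover have "1 = s * inverse s" using s0 by simp
    ultimately have "1 = (\<Sum>i\<le>degree g. s * coeff g i * u ^ i)"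
      by (simp add: poly_altdef sum_distrib_left mult.assoc)
    then show ?thesis using \<open>\<forall>i. coeff g i \<in> R\<close> unfolding rel_def by blast
  qed
  have rel_0: "\<not> rel u 0" for u
  proof
    assume "rel u 0"
    then obtain c where "c \<in> R" "1 = s * c" by (auto simp: rel_def)
    then have "inverse s = c" using s0 by (simp add: field_simps)
    then show False using R \<open>c \<in> R\<close> by simp
  qed
  have rel_mono: "rel u n" if um: "rel u m" "m \<le> n" for u m n
  proof -
    obtain c where c: "\<forall>i. c i \<in> R" "1 = (\<Sum>i\<le>m. s * c i * u ^ i)"
      using um(1) unfolding rel_def by blast
    let ?c = "\<lambda>i. if i \<le> m then c i else 0"
    have "(\<Sum>i\<le>n. s * ?c i * u ^ i) = (\<Sum>i\<le>m. s * ?c i * u ^ i)"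
      using um(2) by (intro sum.mono_neutral_right) auto
    also have "\<dots> = 1" using c(2) by simp
    finally have "1 = (\<Sum>i\<le>n. s * ?c i * u ^ i)" by simp
    moreover have "\<forall>i. ?c i \<in> R" using c(1) RD(1) by simp
    ultimately show ?thesis unfolding rel_def by (intro exI[of _ ?c] conjI)
  qed
  \<comment> \<open>In the relation for \<open>inverse u\<close> the constant term moves to the
    left, where \<open>1 - s * b 0\<close> is a unit. Multiplying by \<open>u ^ n\<close> expresses
    \<open>u ^ n\<close> through lower powers; substituting this for the top term of the relation
    for \<open>u\<close> shortens it, against minimality.\<close>
  have descent: False
    if u: "u \<noteq> 0" and un: "rel u n" "\<And>m. m < n \<Longrightarrow> \<not> rel u m" and w: "rel (inverse u) n" for u n
  proof -
    obtain c where c: "\<forall>i. c i \<in> R" "1 = (\<Sum>i\<le>n. s * c i * u ^ i)"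
      using un(1) unfolding rel_def by blast
    obtain b where b: "\<forall>i. b i \<in> R" "1 = (\<Sum>i\<le>n. s * b i * inverse u ^ i)"
      using w unfolding rel_def by blast
    obtain n' where n': "n = Suc n'" using un(1) rel_0 by (cases n) auto
    define e where "e = inverse (1 - s * b 0)"
    have e: "e \<in> R" using unit b(1) by (simp add: e_def)
    have sb: "1 - s * b 0 \<noteq> 0"
    proof
      assume "1 - s * b 0 = 0"
      then have "inverse s = b 0" using s0 by (simp add: field_simps)
      then show False using b(1) R(3) by simp
    qed
    have "1 - s * b 0 = (\<Sum>i\<le>n'. s * b (Suc i) * inverse u ^ Suc i)"
      using b(2) sum.atMost_Suc_shift[of "\<lambda>i. s * b i * inverse u ^ i" n'] n'
      by (simp add: algebra_simps)
    then have "e * (1 - s * b 0) = (\<Sum>i\<le>n'. s * (e * b (Suc i)) * inverse u ^ Suc i)"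
      by (simp add: sum_distrib_left mult_ac)
    then have "u ^ n * 1 = u ^ n * (\<Sum>i\<le>n'. s * (e * b (Suc i)) * inverse u ^ Suc i)"
      using sb by (simp add: e_def)
    also have "\<dots> = (\<Sum>i\<le>n'. s * (e * b (Suc i)) * u ^ (n' - i))"
      unfolding sum_distrib_left
    proof (rule sum.cong)
      fix i assume "i \<in> {..n'}"
      then have "u ^ n = u ^ (n' - i) * u ^ Suc i" by (simp add: n' flip: power_add)
      then show "u ^ n * (s * (e * b (Suc i)) * inverse u ^ Suc i)
          = s * (e * b (Suc i)) * u ^ (n' - i)"
        using u by (simp add: power_inverse field_simps)
    qed simp
    also have "\<dots> = (\<Sum>i\<le>n'. s * (e * b (Suc (n' - i))) * u ^ i)"
      by (rule sum.reindex_bij_witness[of _ "\<lambda>i. n' - i" "\<lambda>i. n' - i"]) auto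
    finally have un': "u ^ n = (\<Sum>i\<le>n'. s * (e * b (Suc (n' - i))) * u ^ i)" by simp
    have "1 = (\<Sum>i\<le>n'. s * c i * u ^ i) + s * c n * u ^ n" using c(2) by (simp add: n')
    also have "\<dots> = (\<Sum>i\<le>n'. s * (c i + s * c n * (e * b (Suc (n' - i)))) * u ^ i)"
      unfolding un' by (simp add: sum_distrib_left algebra_simps sum.distrib)
    finally have "rel u n'"
      unfolding rel_def using c(1) b(1) e RD R(2)
      by (intro exI[of _ "\<lambda>i. c i + s * c n * (e * b (Suc (n' - i)))"]) simp
    then show False using un(2) n' by simp
  qed
  have "valuation_ring R"
    unfolding valuation_ring_def
  proof (intro conjI allI R(1))
    fix u
    show "u \<in> R \<or> inverse u \<in> R"
    proof (rule ccontr)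
      assume "\<not> ?thesis"
      then have u: "u \<notin> R" "inverse u \<notin> R" by auto
      then have u0: "u \<noteq> 0" using RD(1) by auto
      define n m where "n = (LEAST n. rel u n)" and "m = (LEAST n. rel (inverse u) n)"
      have n: "rel u n" "\<And>k. k < n \<Longrightarrow> \<not> rel u k"
        using LeastI_ex[OF rel_ex[OF u(1)]] not_less_Least by (auto simp: n_def)
      have m: "rel (inverse u) m" "\<And>k. k < m \<Longrightarrow> \<not> rel (inverse u) k"
        using LeastI_ex[OF rel_ex[OF u(2)]] not_less_Least by (auto simp: m_def)
      \<comment> \<open>The shorter of the two minimal relations is padded by zeros to the length of
        the longer, and the longer one is then shortened.\<close>
      show False
      proof (cases "m \<le> n")
        case True
        then show False using descent[OF u0 n] rel_mono[OF m(1)] by blast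
      next
        case False
        then show False using descent[of "inverse u" m] m rel_mono[OF n(1), of m] u0 by auto
      qed
    qed
  qed
  then show ?thesis using that R by blast
qed

text \<open>A relation \<open>inverse s = poly g s\<close> makes \<open>s\<close> a root of
  \<open>X * g - 1\<close>. In a finite subring every nonzero element is a unit, so this polynomial
  can be made monic, and the powers of \<open>s\<close> below its degree span the
  adjunction.\<close>

lemma finite_adjoin:
  fixes s :: "'f::field"
  assumes E: "ring_closed E" "finite E" and s: "s \<noteq> 0" "inverse s \<in> adjoin E s"
  shows "finite (adjoin E s)"
proof -
  note ED = ring_closedD[OF E(1)]
  obtain g where g: "\<forall>i. coeff g i \<in> E" "inverse s = poly g s" using s(2) by (auto simp: adjoin_def)
  define f where "f = pCons (-1) g"
  have f0: "f \<noteq> 0" by (simp add: f_def)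
  have fE: "coeff f i \<in> E" for i
    using g(1) ED(2,3) by (simp add: f_def coeff_pCons split: nat.split)
  have fs: "poly f s = 0" using s(1) g(2)[symmetric] by (simp add: f_def)
  define c n where "c = lead_coeff f" and "n = degree f"
  have c: "c \<in> E" "c \<noteq> 0" using f0 fE by (auto simp: c_def)
  obtain k where k: "k > 0" "c ^ k = 1"
    using finite_closed_torsion[OF E(2) _ c(2)] ED(7)[OF c(1)] by blast
  then have "inverse c = c ^ (k - 1)" using c(2) by (cases k) (auto simp: field_simps)
  then have ci: "inverse c \<in> E" using ED(7)[OF c(1)] by simp
  define d where "d i = - inverse c * coeff f i" for i
  have dE: "d i \<in> E" for i unfolding d_def using ED(3,6) ci fE by blast
  have "0 = (\<Sum>i<n. coeff f i * s ^ i) + c * s ^ n"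
    using fs unfolding poly_altdef n_def c_def lessThan_Suc_atMost[symmetric] by simp
  then have "c * s ^ n = - (\<Sum>i<n. coeff f i * s ^ i)" by (simp add: eq_neg_iff_add_eq_0 add.commute)
  then have "s ^ n = inverse c * - (\<Sum>i<n. coeff f i * s ^ i)" using c(2) by (simp add: field_simps)
  then have sn: "s ^ n = (\<Sum>i<n. d i * s ^ i)"
    by (simp add: d_def sum_distrib_left sum_negf mult.assoc)
  have "n \<noteq> 0"
  proof
    assume "n = 0"
    then show False using sn by simp
  qed
  then obtain n' where n': "n = Suc n'" by (cases n) auto
  let ?V = "(\<lambda>c. \<Sum>i<n. c i * s ^ i) ` ({..<n} \<rightarrow>\<^sub>E E)"
  have VI: "(\<Sum>i<n. e i * s ^ i) \<in> ?V" if "\<And>i. i < n \<Longrightarrow> e i \<in> E" for e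
  proof (rule image_eqI)
    show "restrict e {..<n} \<in> {..<n} \<rightarrow>\<^sub>E E" using that by auto
  qed simp
  have "poly h s \<in> ?V" if "\<forall>i. coeff h i \<in> E" for h
    using that
  proof (induction h)
    case 0
    then show ?case using VI[of "\<lambda>_. 0"] ED(1) by simp
  next
    case (pCons a h)
    have a: "a \<in> E" using pCons.prems[rule_format, of 0] by simp
    have "\<forall>i. coeff h i \<in> E" using pCons.prems by (metis coeff_pCons_Suc)
    then obtain e where e: "e \<in> {..<n} \<rightarrow>\<^sub>E E" "poly h s = (\<Sum>i<n. e i * s ^ i)"
      using pCons.IH by auto
    have eE: "i < n \<Longrightarrow> e i \<in> E" for i using e(1) by auto
    \<comment> \<open>Multiplication by \<open>s\<close> shifts the coefficients by one; the
      overflowing term \<open>e n' * s ^ n\<close> is rewritten by the monic relation.\<close>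
    let ?e = "\<lambda>i. (case i of 0 \<Rightarrow> a | Suc j \<Rightarrow> e j) + e n' * d i"
    have "poly (pCons a h) s = a + (\<Sum>i<n. e i * s ^ Suc i)"
      by (simp add: e(2) sum_distrib_left mult_ac)
    also have "\<dots> = a + (\<Sum>i<n'. e i * s ^ Suc i) + e n' * s ^ n"
      by (simp add: n')
    also have "a + (\<Sum>i<n'. e i * s ^ Suc i) = (\<Sum>i<n. (case i of 0 \<Rightarrow> a | Suc j \<Rightarrow> e j) * s ^ i)"
      unfolding n' sum.lessThan_Suc_shift by simp
    also have "\<dots> + e n' * s ^ n = (\<Sum>i<n. ?e i * s ^ i)"
      unfolding sn by (simp add: sum_distrib_left sum.distrib distrib_right mult.assoc)
    also have "\<dots> \<in> ?V"
    proof (rule VI)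
      fix i assume "i < n"
      then show "?e i \<in> E" using a eE dE ED(4,6) n' by (cases i) auto
    qed
    finally show ?case .
  qed
  then have "adjoin E s \<subseteq> ?V" by (auto simp: adjoin_def)
  moreover have "finite ?V" using E(2) by (intro finite_imageI finite_PiE) auto
  ultimately show ?thesis by (rule finite_subset)
qed

lemma finite_range_of_int:
  assumes "p > 0" "of_nat p = (0::'f::field)"
  shows "finite (range (of_int :: int \<Rightarrow> 'f))"
proof -
  have "range (of_int :: int \<Rightarrow> 'f) \<subseteq> of_int ` {0..<int p}"
  proof
    fix x :: 'f assume "x \<in> range of_int"
    then obtain k where k: "x = of_int k" by auto
    have "of_int (int p) = (0::'f)" using assms(2) by simp
    then have "x = of_int (k mod int p)"
      using arg_cong[OF div_mult_mod_eq[of k "int p"], of "of_int :: int \<Rightarrow> 'f"] k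
      by (simp only: of_int_add of_int_mult) simp
    then show "x \<in> of_int ` {0..<int p}" using assms(1) by auto
  qed
  then show ?thesis by (rule finite_subset) simp
qed

text \<open>The hypothesis forces positive characteristic, so the integers have finite image;
  adjoining the elements of \<open>S\<close> one at a time preserves finiteness.\<close>

lemma finite_subring_exists:
  fixes S :: "'f::field set"
  assumes alg: "\<And>s::'f. s \<noteq> 0 \<Longrightarrow> inverse s \<in> adjoin (range of_int) s" and "finite S"
  shows "\<exists>E. ring_closed E \<and> finite E \<and> S \<subseteq> E"
  using assms(2)
proof induction
  case empty
  have "\<exists>p>0. of_nat p = (0::'f)"
  proof (cases "(2::'f) = 0")
    case True
    then show ?thesis by (intro exI[of _ 2]) simp
  next
    case False
    \<comment> \<open>The hypothesis at \<open>2\<close> makes \<open>1/2\<close> the image of an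
      integer \<open>k\<close>; then the odd, hence nonzero, integer \<open>2 * k - 1\<close>
      vanishes in the field.\<close>
    obtain g where g: "\<forall>i. coeff g i \<in> range (of_int :: int \<Rightarrow> 'f)" "inverse 2 = poly g (2::'f)"
      using alg[OF False] by (auto simp: adjoin_def)
    note ID = ring_closedD[OF ring_closed_range_of_int[where 'f = 'f]]
    have "(2::'f) = of_int 2" by simp
    then have "(2::'f) \<in> range of_int" by blast
    then have "poly g (2::'f) \<in> range of_int"
      unfolding poly_altdef using g(1) by (intro ID(8) ID(6) ID(7)) auto
    then obtain k where k: "inverse 2 = (of_int k :: 'f)" unfolding g(2) by (rule rangeE)
    have "of_int (2 * k - 1) = 2 * (of_int k :: 'f) - 1" by simp
    also have "\<dots> = 0" using False by (simp flip: k)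
    finally have "of_int \<bar>2 * k - 1\<bar> = (0::'f)" by (simp add: abs_if)
    then have "of_nat (nat \<bar>2 * k - 1\<bar>) = (0::'f)"
      by (metis abs_ge_zero of_int_of_nat_eq int_nat_eq)
    moreover have "nat \<bar>2 * k - 1\<bar> > 0" by (simp) presburger
    ultimately show ?thesis by blast
  qed
  then show ?case using finite_range_of_int ring_closed_range_of_int by blast
next
  case (insert s S)
  then obtain E where E: "ring_closed E" "finite E" "S \<subseteq> E" by blast
  show ?case
  proof (cases "s = 0")
    case True
    then show ?thesis using E ring_closedD(1)[OF E(1)] by (intro exI[of _ E]) auto
  next
    case False
    have "range of_int \<subseteq> E" using of_int_in_ring_closed[OF E(1)] by auto
    then have "adjoin (range of_int) s \<subseteq> adjoin E s" unfolding adjoin_def by blast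
    then have "finite (adjoin E s)" using finite_adjoin[OF E(1,2) False] alg[OF False] by blast
    then show ?thesis
      using ring_closed_adjoin[OF E(1)] adjoin_superset[OF E(1)] E(3)
      by (intro exI[of _ "adjoin E s"]) blast
  qed
qed

section \<open>Division rings of finite dimension over their center\<close>

lemma valuation_ring_denominator:
  assumes "valuation_ring R" "finite S"
  shows "\<exists>l\<in>R. l \<noteq> 0 \<and> (\<forall>c\<in>S. l * c \<in> R)"
  using assms(2)
proof induction
  case empty
  have "1 \<in> R" using assms(1) by (simp add: valuation_ring_def ring_closed_def)
  then show ?case by (intro bexI[of _ 1]) auto
next
  case (insert c S)
  note RD = ring_closedD[OF assms(1)[unfolded valuation_ring_def, THEN conjunct1]]
  obtain l where l: "l \<in> R" "l \<noteq> 0" "\<forall>c\<in>S. l * c \<in> R" using insert by blast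
  show ?case
  proof (cases "c \<in> R")
    case True
    then show ?thesis using l RD(6) by (intro bexI[of _ l]) auto
  next
    case False
    \<comment> \<open>An element outside \<open>R\<close> has its own inverse as a denominator in
      \<open>R\<close>.\<close>
    then have "inverse c \<in> R" "c \<noteq> 0" using assms(1) RD(1) by (auto simp: valuation_ring_def)
    moreover have "l * inverse c * a \<in> R" if "a \<in> S" for a
      using RD(6)[OF bspec[OF l(3) that] \<open>inverse c \<in> R\<close>] by (simp add: mult_ac)
    ultimately show ?thesis using l RD(6) by (intro bexI[of _ "l * inverse c"]) (auto simp: mult.assoc)
  qed
qed

text \<open>A common denominator of the inverses works. This is how a neighbourhood contained in
  finitely many given ones is found.\<close>

lemma valuation_ring_common_multiple:
  assumes "valuation_ring R" "finite S" "0 \<notin> S"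
  shows "\<exists>\<pi>. \<pi> \<noteq> 0 \<and> (\<forall>a\<in>S. \<exists>r\<in>R. \<pi> = a * r)"
proof -
  obtain l where l: "l \<in> R" "l \<noteq> 0" "\<forall>c\<in>inverse ` S. l * c \<in> R"
    using valuation_ring_denominator[OF assms(1), of "inverse ` S"] assms(2) by auto
  have "\<exists>r\<in>R. l = a * r" if "a \<in> S" for a
    using l(3) that assms(3) by (intro bexI[of _ "l * inverse a"]) (auto simp: field_simps)
  then show ?thesis using l(2) by auto
qed

text \<open>Divisibility over a valuation ring is total, so a finite family has a member dividing
  all others. It replaces the coordinate of largest absolute value.\<close>

lemma valuation_ring_largest:
  fixes c :: "nat \<Rightarrow> 'f::field"
  assumes R: "valuation_ring R" and "d > 0"
  shows "\<exists>k<d. \<forall>i<d. \<exists>r\<in>R. c i = c k * r"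
  using assms(2)
proof (induction d)
  case (Suc d)
  note RD = ring_closedD[OF R[unfolded valuation_ring_def, THEN conjunct1]]
  show ?case
  proof (cases "d = 0")
    case True
    then show ?thesis using RD(2) by (auto intro!: bexI[of _ 1])
  next
    case False
    then obtain k where k: "k < d" "\<forall>i<d. \<exists>r\<in>R. c i = c k * r" using Suc by auto
    have cases: "i < d \<or> i = d" if "i < Suc d" for i using that by auto
    show ?thesis
    proof (cases "\<exists>r\<in>R. c d = c k * r")
      case True
      then show ?thesis using k cases by (intro exI[of _ k]) auto
    next
      case False
      then have d0: "c d \<noteq> 0" using RD(1) by auto
      have "c k = c d * (c k / c d)" using d0 by simp
      moreover have "c k / c d \<in> R"
      proof (cases "c k = 0")
        case False
        have "c d / c k \<notin> R" using \<open>\<not> (\<exists>r\<in>R. c d = c k * r)\<close> False by (auto simp: field_simps)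
        then have "inverse (c d / c k) \<in> R" using R unfolding valuation_ring_def by blast
        then show ?thesis by simp
      qed (use RD(1) in simp)
      ultimately have "\<exists>r\<in>R. c i = c d * r" if "i < Suc d" for i
        using cases[OF that] k(2) RD(2,6) by (metis mult.assoc mult.right_neutral)
      then show ?thesis by (intro exI[of _ d]) auto
    qed
  qed
qed simp

section \<open>Coordinates over the center\<close>

locale centrally_finite =
  fixes K :: "'a::division_ring set" and \<iota> :: "'f::field \<Rightarrow> 'a"
    and d :: nat and e :: "nat \<Rightarrow> 'a" and co :: "'a \<Rightarrow> nat \<Rightarrow> 'f"
  assumes K: "division_subring K"
    and iota_add: "\<iota> (x + y) = \<iota> x + \<iota> y" and iota_mult: "\<iota> (x * y) = \<iota> x * \<iota> y"
    and iota_1: "\<iota> 1 = 1" and range_iota: "range \<iota> = center_of K"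
    and basis_in: "i < d \<Longrightarrow> e i \<in> K"
    and expand: "v \<in> K \<Longrightarrow> v = (\<Sum>i<d. \<iota> (co v i) * e i)"
    and co_unique: "i < d \<Longrightarrow> co (\<Sum>j<d. \<iota> (c j) * e j) i = c i"
begin

lemmas KD = division_subringD[OF K]

lemma iota_0: "\<iota> 0 = 0"
  using iota_add[of 0 0] by simp

lemma iota_eq_0: "\<iota> x = 0 \<longleftrightarrow> x = 0"
proof
  assume "\<iota> x = 0"
  then show "x = 0"
    using iota_mult[of x "inverse x"] iota_1 by (cases "x = 0") auto
qed (simp add: iota_0)

lemma iota_power: "\<iota> (x ^ n) = \<iota> x ^ n"
  by (induction n) (simp_all add: iota_1 iota_mult)

lemma iota_of_nat: "\<iota> (of_nat n) = of_nat n"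
  by (induction n) (simp_all add: iota_0 iota_1 iota_add)

lemma iota_in: "\<iota> x \<in> K"
  using range_iota center_of_subset by blast

lemma iota_commute: "v \<in> K \<Longrightarrow> \<iota> x * v = v * \<iota> x"
  using range_iota center_ofD by blast

lemma d_pos: "d > 0"
proof (rule ccontr)
  assume "\<not> ?thesis"
  then show False using expand[OF KD(2)] by simp
qed

lemma co_add:
  assumes "v \<in> K" "w \<in> K" "i < d"
  shows "co (v + w) i = co v i + co w i"
proof -
  have "v + w = (\<Sum>i<d. \<iota> (co v i) * e i) + (\<Sum>i<d. \<iota> (co w i) * e i)"
    using expand assms by metis
  also have "\<dots> = (\<Sum>i<d. \<iota> (co v i + co w i) * e i)"
    by (simp add: iota_add distrib_right sum.distrib)
  finally show ?thesis using co_unique[OF assms(3)] by simp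
qed

lemma co_scale:
  assumes "v \<in> K" "i < d"
  shows "co (\<iota> a * v) i = a * co v i"
proof -
  have "\<iota> a * v = \<iota> a * (\<Sum>i<d. \<iota> (co v i) * e i)"
    using expand assms by metis
  also have "\<dots> = (\<Sum>i<d. \<iota> (a * co v i) * e i)"
    by (simp add: iota_mult sum_distrib_left mult.assoc)
  finally show ?thesis using co_unique[OF assms(2)] by simp
qed

lemma co_0: "i < d \<Longrightarrow> co 0 i = 0"
  using co_scale[of 0 i 0] KD(1) by simp

lemma co_uminus: "v \<in> K \<Longrightarrow> i < d \<Longrightarrow> co (- v) i = - co v i"
  using co_add[of v "- v" i] co_0[of i] KD(5)[of v] by (simp add: eq_neg_iff_add_eq_0 add.commute)

lemma co_basis:
  assumes "i < d" "j < d"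
  shows "co (e j) i = (if i = j then 1 else 0)"
proof -
  have "e j = (\<Sum>k<d. if k = j then e k else 0)" using assms by simp
  also have "\<dots> = (\<Sum>k<d. \<iota> (if k = j then 1 else 0) * e k)"
    by (intro sum.cong) (simp_all add: iota_0 iota_1)
  finally show ?thesis using co_unique[OF assms(1), of "\<lambda>k. if k = j then 1 else 0"] by simp
qed

lemma co_linear:
  assumes "\<And>j. j \<in> J \<Longrightarrow> w j \<in> K" "i < d"
  shows "co (\<Sum>j\<in>J. \<iota> (c j) * w j) i = (\<Sum>j\<in>J. c j * co (w j) i)"
  using assms(1)
proof (induction J rule: infinite_finite_induct)
  case (insert j J)
  have "(\<Sum>j\<in>J. \<iota> (c j) * w j) \<in> K"
    using insert.prems by (intro division_subring_sum[OF K] KD(4) iota_in) auto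
  then show ?case
    using insert by (simp add: co_add co_scale KD(4) iota_in assms(2))
qed (simp_all add: co_0 assms(2))

lemma co_mult:
  assumes "v \<in> K" "w \<in> K" "k < d"
  shows "co (v * w) k = (\<Sum>i<d. \<Sum>j<d. co v i * co w j * co (e i * e j) k)"
proof -
  have "v * w = (\<Sum>i<d. \<iota> (co v i) * e i) * w" using expand[OF assms(1)] by simp
  also have "\<dots> = (\<Sum>i<d. \<iota> (co v i) * (e i * w))" by (simp add: sum_distrib_right mult.assoc)
  finally have "co (v * w) k = (\<Sum>i<d. co v i * co (e i * w) k)"
    using co_linear[of "{..<d}" "\<lambda>i. e i * w" k "co v"] assms basis_in KD(4) by simp
  also have "co (e i * w) k = (\<Sum>j<d. co w j * co (e i * e j) k)" if "i < d" for i
  proof -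
    have "e i * w = e i * (\<Sum>j<d. \<iota> (co w j) * e j)" using expand[OF assms(2)] by simp
    also have "\<dots> = (\<Sum>j<d. \<iota> (co w j) * (e i * e j))"
      unfolding sum_distrib_left
    proof (rule sum.cong)
      fix j
      show "e i * (\<iota> (co w j) * e j) = \<iota> (co w j) * (e i * e j)"
        using iota_commute[OF basis_in[OF that], of "co w j"] by (simp add: mult.assoc[symmetric])
    qed simp
    finally show ?thesis
      using co_linear[of "{..<d}" "\<lambda>j. e i * e j" k "co w"] assms basis_in KD(4) that by simp
  qed
  then have "(\<Sum>i<d. co v i * co (e i * w) k) = (\<Sum>i<d. \<Sum>j<d. co v i * co w j * co (e i * e j) k)"
    by (intro sum.cong) (simp_all add: sum_distrib_left mult.assoc)
  finally show ?thesis .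
qed

lemma co_eqI:
  assumes "v \<in> K" "w \<in> K" "\<And>i. i < d \<Longrightarrow> co v i = co w i"
  shows "v = w"
proof -
  have "v = (\<Sum>i<d. \<iota> (co v i) * e i)" using expand assms by blast
  also have "\<dots> = (\<Sum>i<d. \<iota> (co w i) * e i)" using assms(3) by (intro sum.cong) auto
  also have "\<dots> = w" using expand[OF assms(2)] by simp
  finally show ?thesis .
qed

section \<open>The left regular representation and the norm over the center\<close>

definition regular_matrix :: "'a \<Rightarrow> 'f mat" where
  "regular_matrix a = mat d d (\<lambda>(i, j). co (a * e j) i)"

lemma regular_matrix_mult:
  assumes "a \<in> K" "b \<in> K"
  shows "regular_matrix (a * b) = regular_matrix a * regular_matrix b"
proof (rule eq_matI)
  fix i j
  assume "i < dim_row (regular_matrix a * regular_matrix b)"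
    "j < dim_col (regular_matrix a * regular_matrix b)"
  then have ij: "i < d" "j < d" by (auto simp: regular_matrix_def)
  let ?c = "\<lambda>k. co (b * e j) k"
  have bj: "b * e j \<in> K" using assms basis_in ij KD(4) by simp
  have "a * b * e j = a * (\<Sum>k<d. \<iota> (?c k) * e k)" using expand[OF bj] by (simp add: mult.assoc)
  also have "\<dots> = (\<Sum>k<d. \<iota> (?c k) * (a * e k))"
    unfolding sum_distrib_left
  proof (rule sum.cong)
    fix k
    show "a * (\<iota> (?c k) * e k) = \<iota> (?c k) * (a * e k)"
      using iota_commute[OF assms(1), of "?c k"] by (simp add: mult.assoc[symmetric])
  qed simp
  finally have "co (a * b * e j) i = (\<Sum>k<d. ?c k * co (a * e k) i)"
    using co_linear[of "{..<d}" "\<lambda>k. a * e k" i ?c] assms basis_in KD(4) ij by simp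
  then show "regular_matrix (a * b) $$ (i, j) = (regular_matrix a * regular_matrix b) $$ (i, j)"
    using ij by (simp add: regular_matrix_def scalar_prod_def lessThan_atLeast0 mult.commute)
qed (simp_all add: regular_matrix_def)

lemma regular_matrix_iota: "regular_matrix (\<iota> x) = x \<cdot>\<^sub>m 1\<^sub>m d"
  by (rule eq_matI) (simp_all add: regular_matrix_def co_scale basis_in co_basis)

text \<open>The full norm of \<open>K\<close> over its center, not the reduced one, so on the center
  it is the \<open>d\<close>-th power. Its determinant is the reason for representing the center by
  a field type through \<open>\<iota>\<close>.\<close>

definition norm_form :: "'a \<Rightarrow> 'f" where
  "norm_form a = det (regular_matrix a)"

lemma norm_form_mult: "a \<in> K \<Longrightarrow> b \<in> K \<Longrightarrow> norm_form (a * b) = norm_form a * norm_form b"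
  unfolding norm_form_def
  by (subst regular_matrix_mult) (auto intro!: det_mult simp: regular_matrix_def)

lemma norm_form_iota: "norm_form (\<iota> x) = x ^ d"
  by (simp add: norm_form_def regular_matrix_iota)

lemma norm_form_1: "norm_form 1 = 1"
  using norm_form_iota[of 1] by (simp add: iota_1)

lemma norm_form_power: "a \<in> K \<Longrightarrow> norm_form (a ^ n) = norm_form a ^ n"
  by (induction n) (simp_all add: norm_form_1 norm_form_mult KD(8))

text \<open>A multiplicative map into a field sends commutators to \<open>1\<close>. If
  \<open>z ^ k = \<iota> f\<close>, comparing norms gives \<open>f ^ d = 1\<close>, hence
  \<open>z ^ (k * d) = 1\<close>.\<close>

lemma commutator_torsion:
  assumes ax: "a \<in> K" "a \<noteq> 0" "x \<in> K" "x \<noteq> 0" and z: "z = a * x * inverse a * inverse x"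
    and k: "k > 0" "z ^ k \<in> center_of K"
  shows "\<exists>n>0. z ^ n = 1"
proof -
  have zK: "z \<in> K" using ax KD(4,6) by (simp add: z)
  have "norm_form z = norm_form (a * inverse a) * norm_form (x * inverse x)"
    using ax KD(4,6) by (simp add: z norm_form_mult del: right_inverse)
  then have "norm_form z = 1" using ax by (simp add: norm_form_1)
  moreover obtain f where f: "z ^ k = \<iota> f" using k(2) range_iota by blast
  ultimately have "f ^ d = 1" using norm_form_power[OF zK, of k] norm_form_iota[of f] by simp
  then have "z ^ (k * d) = 1" by (simp add: power_mult f iota_1 flip: iota_power)
  then show ?thesis using k(1) d_pos by (intro exI[of _ "k * d"]) simp
qed

text \<open>Some finite subring \<open>E\<close> of the center field contains the structure
  constants and the coordinates of \<open>x\<close>, \<open>y\<close> and \<open>1\<close>. The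
  elements of \<open>K\<close> with coordinates in \<open>E\<close> form a finite division ring, to
  which Wedderburn's theorem applies.\<close>

lemma locally_finite_center_commute:
  assumes alg: "\<And>s::'f. s \<noteq> 0 \<Longrightarrow> inverse s \<in> adjoin (range of_int) s"
    and xy: "x \<in> K" "y \<in> K"
  shows "x * y = y * x"
proof -
  define S where "S = (\<lambda>(i, j, k). co (e i * e j) k) ` ({..<d} \<times> {..<d} \<times> {..<d})
    \<union> co x ` {..<d} \<union> co y ` {..<d} \<union> co 1 ` {..<d}"
  have "finite S" by (simp add: S_def)
  then obtain E where E: "ring_closed E" "finite E" "S \<subseteq> E" using finite_subring_exists[OF alg] by blast
  note ED = ring_closedD[OF E(1)]
  have S: "co (e i * e j) k \<in> E" "co x i \<in> E" "co y i \<in> E" "co 1 i \<in> E"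
    if "i < d" "j < d" "k < d" for i j k
  proof -
    have "co (e i * e j) k \<in> S" using that unfolding S_def by (intro UnI1 image_eqI[of _ _ "(i, j, k)"]) auto
    then show "co (e i * e j) k \<in> E" using E(3) by auto
    show "co x i \<in> E" "co y i \<in> E" "co 1 i \<in> E" using that E(3) by (auto simp: S_def)
  qed
  define L where "L = {v \<in> K. \<forall>i<d. co v i \<in> E}"
  have "L \<subseteq> (\<lambda>c. \<Sum>i<d. \<iota> (c i) * e i) ` ({..<d} \<rightarrow>\<^sub>E E)"
  proof
    fix v assume v: "v \<in> L"
    show "v \<in> (\<lambda>c. \<Sum>i<d. \<iota> (c i) * e i) ` ({..<d} \<rightarrow>\<^sub>E E)"
    proof (rule image_eqI)
      show "v = (\<Sum>i<d. \<iota> (restrict (co v) {..<d} i) * e i)" using expand[of v] v by (simp add: L_def)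
      show "restrict (co v) {..<d} \<in> {..<d} \<rightarrow>\<^sub>E E" using v by (auto simp: L_def)
    qed
  qed
  then have finL: "finite L"
    by (rule finite_subset) (use E(2) in \<open>intro finite_imageI finite_PiE; simp\<close>)
  have mult: "v * w \<in> L" if "v \<in> L" "w \<in> L" for v w
  proof -
    have "co (v * w) k \<in> E" if "k < d" for k
    proof -
      have "co (v * w) k = (\<Sum>i<d. \<Sum>j<d. co v i * co w j * co (e i * e j) k)"
        using \<open>v \<in> L\<close> \<open>w \<in> L\<close> that by (intro co_mult) (auto simp: L_def)
      also have "\<dots> \<in> E"
        using \<open>v \<in> L\<close> \<open>w \<in> L\<close> that by (intro ED(8) ED(6)) (auto simp: L_def S)
      finally show ?thesis .
    qed
    then show ?thesis using that KD(4) by (auto simp: L_def)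
  qed
  have one: "1 \<in> L" using KD(2) S(4)[OF _ d_pos d_pos] by (auto simp: L_def)
  have pow: "v ^ n \<in> L" if "v \<in> L" for v n by (induction n) (simp_all add: one mult that)
  \<comment> \<open>Finiteness of \<open>L\<close> makes \<open>v\<close> torsion, so its inverse is
    one of its powers.\<close>
  have inv: "inverse v \<in> L" if v: "v \<in> L" "v \<noteq> 0" for v
  proof -
    obtain n where n: "n > 0" "v ^ n = 1" using finite_closed_torsion[OF finL pow[OF v(1)] v(2)] by blast
    then have "v * v ^ (n - 1) = 1" by (cases n) auto
    then have "inverse v = v ^ (n - 1)" by (rule inverse_unique)
    then show ?thesis using pow v by simp
  qed
  have "division_subring L"
    unfolding division_subring_def
    using inv mult one
    by (auto simp: L_def KD co_0 co_add co_uminus ED)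
  moreover have "x \<in> L" "y \<in> L" using xy S(2,3)[OF _ d_pos d_pos] by (auto simp: L_def)
  ultimately show ?thesis using finite_division_subring_commutative[OF finL] by blast
qed

end


lemma mult_subgroup_if_subnormal: "subnormal N \<Longrightarrow> mult_subgroup N"
  by (induction rule: subnormal.induct) (auto simp: mult_subgroup_def normal_in_def)

section \<open>Lattices over a valuation ring and the topology they define\<close>

locale centrally_finite_valued = centrally_finite K \<iota> d e co
  for K :: "'a::division_ring set" and \<iota> :: "'f::field \<Rightarrow> 'a" and d e co +
  fixes R :: "'f set" and s l :: 'f
  assumes R: "valuation_ring R" and s: "s \<in> R" "inverse s \<notin> R"
    and l0: "l \<noteq> 0"
    and structure_constants: "i < d \<Longrightarrow> j < d \<Longrightarrow> k < d \<Longrightarrow> l * co (e i * e j) k \<in> R"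
begin

lemma R_closed: "ring_closed R"
  using R by (simp add: valuation_ring_def)

lemmas RD = ring_closedD[OF R_closed]

lemma s0: "s \<noteq> 0"
  using s RD(1) by auto

text \<open>\<open>s\<close> is a nonunit of \<open>R\<close>. For \<open>x = 1 + s * r\<close> the
  quotient \<open>x / s\<close> cannot lie in \<open>R\<close>, so \<open>s / x\<close> does, and
  \<open>1 - (s / x) * r = inverse x\<close>.\<close>

lemma unit_1_plus: "r \<in> R \<Longrightarrow> 1 + s * r \<noteq> 0 \<and> inverse (1 + s * r) \<in> R"
proof -
  assume r: "r \<in> R"
  define x where "x = 1 + s * r"
  have "x / s \<notin> R"
  proof
    assume "x / s \<in> R"
    then have "x / s - r \<in> R" using RD(5) r by blast
    moreover have "x / s - r = inverse s" using s0 by (simp add: x_def field_simps)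
    ultimately show False using s by simp
  qed
  then have x0: "x \<noteq> 0" and "inverse (x / s) \<in> R"
    using RD(1) R by (auto simp: valuation_ring_def)
  then have "1 - inverse (x / s) * r \<in> R" using r by (intro RD(5) RD(2) RD(6))
  moreover have "1 - inverse (x / s) * r = inverse x" using x0 by (simp add: x_def field_simps)
  ultimately show ?thesis using x0 by (simp add: x_def)
qed

text \<open>\<open>scaled_lattice \<pi>\<close> is \<open>\<pi>\<close> times the \<open>R\<close>-lattice spanned by the \<open>l e\<^sub>i\<close>; the factor \<open>l\<close>
  makes that lattice closed under multiplication.\<close>

definition scaled_lattice :: "'f \<Rightarrow> 'a set" where
  "scaled_lattice \<pi> = {v \<in> K. \<forall>i<d. \<exists>r\<in>R. co v i = \<pi> * l * r}"

lemma lattice_0: "0 \<in> scaled_lattice \<pi>"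
  using RD(1) KD(1) by (auto simp: scaled_lattice_def co_0 intro!: bexI[of _ 0])

lemma lattice_add: "v \<in> scaled_lattice \<pi> \<Longrightarrow> w \<in> scaled_lattice \<pi> \<Longrightarrow> v + w \<in> scaled_lattice \<pi>"
  unfolding scaled_lattice_def using KD(3) RD(4)
  by (auto simp: co_add) (metis distrib_left)

lemma lattice_uminus: "v \<in> scaled_lattice \<pi> \<Longrightarrow> - v \<in> scaled_lattice \<pi>"
  unfolding scaled_lattice_def using KD(5) RD(3)
  by (auto simp: co_uminus) (metis mult_minus_right)

lemma lattice_sum: "(\<And>i. i \<in> I \<Longrightarrow> f i \<in> scaled_lattice \<pi>) \<Longrightarrow> sum f I \<in> scaled_lattice \<pi>"
  by (induction I rule: infinite_finite_induct) (simp_all add: lattice_0 lattice_add)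

lemma lattice_mono: "r \<in> R \<Longrightarrow> scaled_lattice (\<pi> * r) \<subseteq> scaled_lattice \<pi>"
proof
  fix v assume r: "r \<in> R" and v: "v \<in> scaled_lattice (\<pi> * r)"
  have "\<exists>t\<in>R. co v i = \<pi> * l * t" if i: "i < d" for i
  proof -
    obtain t where "t \<in> R" "co v i = \<pi> * r * l * t" using v i by (auto simp: scaled_lattice_def)
    then show ?thesis using RD(6) r by (intro bexI[of _ "r * t"]) (simp_all add: mult_ac)
  qed
  then show "v \<in> scaled_lattice \<pi>" using v by (auto simp: scaled_lattice_def)
qed

text \<open>The coordinates of the factors contribute \<open>l\<close> twice; one copy makes the
  structure constants integral and the other is the \<open>l\<close> of the product lattice.\<close>

lemma lattice_mult:
  assumes v: "v \<in> scaled_lattice \<pi>" and w: "w \<in> scaled_lattice \<rho>"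
  shows "v * w \<in> scaled_lattice (\<pi> * \<rho>)"
proof -
  have "\<forall>i. \<exists>r. i < d \<longrightarrow> r \<in> R \<and> co v i = \<pi> * l * r" using v by (auto simp: scaled_lattice_def)
  then obtain a where a: "\<And>i. i < d \<Longrightarrow> a i \<in> R \<and> co v i = \<pi> * l * a i" by metis
  have "\<forall>i. \<exists>r. i < d \<longrightarrow> r \<in> R \<and> co w i = \<rho> * l * r" using w by (auto simp: scaled_lattice_def)
  then obtain b where b: "\<And>i. i < d \<Longrightarrow> b i \<in> R \<and> co w i = \<rho> * l * b i" by metis
  have vw: "v \<in> K" "w \<in> K" using v w by (auto simp: scaled_lattice_def)
  have "\<exists>r\<in>R. co (v * w) k = \<pi> * \<rho> * l * r" if k: "k < d" for k
  proof
    show "(\<Sum>i<d. \<Sum>j<d. a i * b j * (l * co (e i * e j) k)) \<in> R"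
      by (intro RD(8) RD(6)[OF RD(6)] structure_constants k) (use a b in auto)
    show "co (v * w) k = \<pi> * \<rho> * l * (\<Sum>i<d. \<Sum>j<d. a i * b j * (l * co (e i * e j) k))"
      unfolding co_mult[OF vw k] sum_distrib_left using a b
      by (intro sum.cong) (auto simp: mult_ac)
  qed
  then show ?thesis using vw KD(4) by (auto simp: scaled_lattice_def)
qed

lemma lattice_mult_self:
  assumes "\<pi> \<in> R" "v \<in> scaled_lattice \<pi>" "w \<in> scaled_lattice \<pi>"
  shows "v * w \<in> scaled_lattice \<pi>"
  using lattice_mult[OF assms(2,3)] lattice_mono[OF assms(1)] by blast

lemma lattice_power:
  assumes "\<pi> \<in> R" "z - 1 \<in> scaled_lattice \<pi>"
  shows "z ^ n - 1 \<in> scaled_lattice \<pi>"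
proof (induction n)
  case (Suc n)
  have "z ^ Suc n - 1 = (z - 1) * (z ^ n - 1) + (z - 1) + (z ^ n - 1)"
    by (simp add: algebra_simps)
  then show ?case using Suc assms by (simp only: lattice_add lattice_mult_self)
qed (simp add: lattice_0)

lemma one_notin_lattice: "\<exists>\<pi>. \<pi> \<noteq> 0 \<and> 1 \<notin> scaled_lattice \<pi>"
proof -
  obtain i where i: "i < d" "co 1 i \<noteq> 0"
  proof -
    have "\<exists>i<d. co 1 i \<noteq> 0"
      using co_eqI[of 1 0] KD(1,2) co_0 by fastforce
    then show ?thesis using that by blast
  qed
  \<comment> \<open>Chosen so that membership of \<open>1\<close> would read
    \<open>co 1 i = co 1 i * (s * r)\<close> and make \<open>s\<close> a unit of
    \<open>R\<close>.\<close>
  define \<pi> where "\<pi> = s * co 1 i / l"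
  have "1 \<notin> scaled_lattice \<pi>"
  proof
    assume "1 \<in> scaled_lattice \<pi>"
    then obtain r where r: "r \<in> R" "co 1 i = \<pi> * l * r" using i by (auto simp: scaled_lattice_def)
    then have "co 1 i * 1 = co 1 i * (s * r)" using l0 by (simp add: \<pi>_def mult_ac)
    then have "s * r = 1" using i by simp
    then have "inverse s = r" by (rule inverse_unique)
    then show False using r s by simp
  qed
  moreover have "\<pi> \<noteq> 0" using i s0 l0 by (simp add: \<pi>_def)
  ultimately show ?thesis by blast
qed

text \<open>One of \<open>q / p\<close> and \<open>p / q\<close> lies in \<open>R\<close>; dividing
  the Bezout identity \<open>p * u = q * v + 1\<close> by \<open>p\<close> or by \<open>q\<close>
  then puts the inverse of that prime into \<open>R\<close>.\<close>

lemma residue_characteristic_unique: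
  assumes p: "prime p" "of_nat p \<noteq> (0::'f)" "inverse (of_nat p) \<notin> R"
    and q: "prime q" "of_nat q \<noteq> (0::'f)" "inverse (of_nat q) \<notin> R"
  shows "p = q"
proof (rule ccontr)
  assume "p \<noteq> q"
  then have "coprime p q" using p q primes_coprime by blast
  then obtain u v where "p * u = q * v + 1"
    using coprime_bezout_strong[of p q] prime_gt_1_nat[OF q(1)] by auto
  then have eq: "of_nat p * of_nat u = of_nat q * of_nat v + (1::'f)"
    by (metis of_nat_1 of_nat_add of_nat_mult)
  have nat: "of_nat n \<in> R" for n using of_int_in_ring_closed[OF R_closed, of "int n"] by simp
  have "of_nat q / of_nat p \<in> R \<or> inverse (of_nat q / of_nat p :: 'f) \<in> R"
    using R unfolding valuation_ring_def by blast
  then show False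
  proof
    assume *: "of_nat q / of_nat p \<in> R"
    have "of_nat u - (of_nat q / of_nat p) * of_nat v \<in> R" by (intro RD(5) RD(6) * nat)
    moreover have "of_nat u - (of_nat q / of_nat p) * of_nat v = inverse (of_nat p :: 'f)"
      using eq p(2) by (simp add: field_simps)
    ultimately show False using p by simp
  next
    assume *: "inverse (of_nat q / of_nat p) \<in> R"
    have "inverse (of_nat q / of_nat p) * of_nat u - of_nat v \<in> R" by (intro RD(5) RD(6) * nat)
    moreover have "inverse (of_nat q / of_nat p) * of_nat u - of_nat v = inverse (of_nat q :: 'f)"
      using eq q(2) by (simp add: field_simps)
    ultimately show False using q by simp
  qed
qed

lemma torsion_near_1:
  obtains \<pi> where "\<pi> \<noteq> 0" "\<exists>r\<in>R. \<pi> = s * r"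
    "\<And>z. z \<in> K \<Longrightarrow> z - 1 \<in> scaled_lattice \<pi> \<Longrightarrow> \<exists>n>0. z ^ n = 1 \<Longrightarrow> z = 1"
proof -
  obtain \<pi>0 where \<pi>0: "\<pi>0 \<noteq> 0" "1 \<notin> scaled_lattice \<pi>0" using one_notin_lattice by blast
  define P where "P = {p. prime p \<and> of_nat p \<noteq> (0::'f) \<and> inverse (of_nat p) \<notin> R}"
  have "finite P"
  proof (cases "P = {}")
    case False
    then obtain p where "p \<in> P" by auto
    then have "P \<subseteq> {p}" using residue_characteristic_unique by (auto simp: P_def)
    then show ?thesis by (rule finite_subset) simp
  qed simp
  \<comment> \<open>One \<open>\<pi>\<close> must serve all prime orders at once. Only a prime that
    is a nonunit of \<open>R\<close> needs its own multiple \<open>of_nat p * \<pi>0\<close>, and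
    there is at most one.\<close>
  define S where "S = {s, \<pi>0} \<union> (\<lambda>p. of_nat p * \<pi>0) ` P"
  have "finite S" "0 \<notin> S" using \<open>finite P\<close> s0 \<pi>0 by (auto simp: S_def P_def)
  then obtain \<pi> where \<pi>: "\<pi> \<noteq> 0" "\<forall>a\<in>S. \<exists>r\<in>R. \<pi> = a * r"
    using valuation_ring_common_multiple[OF R] by blast
  have \<pi>s: "\<exists>r\<in>R. \<pi> = s * r" using \<pi>(2) by (simp add: S_def)
  then have \<pi>R: "\<pi> \<in> R" using s RD(6) by auto
  have "z = 1" if z: "z \<in> K" "z - 1 \<in> scaled_lattice \<pi>" and tor: "\<exists>n>0. z ^ n = 1" for z
  proof (rule ccontr)
    assume "z \<noteq> 1"
    note n = torsion_order[OF tor]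
    have "torsion_order z \<noteq> 1" using n(2) \<open>z \<noteq> 1\<close> by auto
    then obtain p where p: "prime p" "p dvd torsion_order z" using prime_factor_nat by blast
    then obtain m where m: "torsion_order z = m * p" by (metis dvdE mult.commute)
    define y where "y = z ^ m"
    have yp: "y ^ p = 1" using n(2) by (simp add: y_def m flip: power_mult)
    have "0 < m" "m < torsion_order z" using m n(1) prime_gt_1_nat[OF p(1)] by auto
    then have y1: "y \<noteq> 1" using n(3) by (simp add: y_def)
    have p0': "of_nat p \<noteq> (0::'a)" using prime_char_power_eq_one[OF p(1) _ yp] y1 by blast
    then have p0: "of_nat p \<noteq> (0::'f)" using iota_of_nat[of p] iota_0 by auto
    have y: "y - 1 \<in> scaled_lattice \<pi>" unfolding y_def by (rule lattice_power[OF \<pi>R z(2)])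
    \<comment> \<open>The \<open>p\<close> powers of \<open>y\<close> sum to \<open>0\<close>, so
      subtracting \<open>1\<close> from each leaves \<open>- of_nat p\<close> as a sum of small
      elements.\<close>
    have "(\<Sum>i<p. y ^ i - 1) = - of_nat p"
      using geometric_sum_root_of_unity[OF yp y1] by (simp add: sum_subtractf)
    moreover have "(\<Sum>i<p. y ^ i - 1) \<in> scaled_lattice \<pi>"
      by (intro lattice_sum lattice_power[OF \<pi>R y])
    ultimately have "of_nat p \<in> scaled_lattice \<pi>" using lattice_uminus by force
    then have "\<exists>r\<in>R. co (of_nat p) i = \<pi> * l * r" if "i < d" for i
      using that by (simp add: scaled_lattice_def)
    moreover have "co (of_nat p) i = of_nat p * co 1 i" if "i < d" for i
      using co_scale[OF KD(2) that, of "of_nat p"] by (simp add: iota_of_nat)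
    ultimately have coef: "\<exists>r\<in>R. of_nat p * co 1 i = \<pi> * l * r" if "i < d" for i
      using that by metis
    \<comment> \<open>This allows cancelling \<open>p\<close> from the coordinates of
      \<open>of_nat p\<close>, so that \<open>1\<close> lands in
      \<open>scaled_lattice \<pi>0\<close>, which was chosen to exclude it.\<close>
    have "\<exists>t\<in>R. \<pi> = of_nat p * \<pi>0 * t"
    proof (cases "p \<in> P")
      case True
      then show ?thesis using \<pi>(2) by (auto simp: S_def)
    next
      case False
      then have "inverse (of_nat p) \<in> R" using p p0 by (auto simp: P_def)
      moreover obtain t where t: "t \<in> R" "\<pi> = \<pi>0 * t" using \<pi>(2) by (auto simp: S_def)
      ultimately have "inverse (of_nat p) * t \<in> R" by (intro RD(6))
      moreover have "\<pi> = of_nat p * \<pi>0 * (inverse (of_nat p) * t)"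
        using t(2) p0 by (simp add: field_simps)
      ultimately show ?thesis by blast
    qed
    then obtain t where t: "t \<in> R" "\<pi> = of_nat p * \<pi>0 * t" by blast
    have "\<exists>r\<in>R. co 1 i = \<pi>0 * l * r" if i: "i < d" for i
    proof -
      obtain r where r: "r \<in> R" "of_nat p * co 1 i = \<pi> * l * r" using coef[OF i] by blast
      then have "of_nat p * co 1 i = of_nat p * (\<pi>0 * l * (t * r))" by (simp add: t mult_ac)
      then have "co 1 i = \<pi>0 * l * (t * r)" using p0 by simp
      then show ?thesis using RD(6)[OF t(1) r(1)] by blast
    qed
    then have "1 \<in> scaled_lattice \<pi>0" using KD(2) by (simp add: scaled_lattice_def)
    then show False using \<pi>0 by simp
  qed
  then show ?thesis using that \<pi>(1) \<pi>s by blast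
qed

section \<open>Continuity of inversion, conjugation and commutators at 1\<close>

lemma inverse_near_1:
  assumes \<pi>: "\<exists>r\<in>R. \<pi> = s * r" and a: "a \<in> K" "a \<noteq> 0" "a - 1 \<in> scaled_lattice \<pi>"
  shows "inverse a - 1 \<in> scaled_lattice \<pi>"
proof -
  define u v where "u = a - 1" and "v = inverse a - 1"
  have uv: "u \<in> K" "v \<in> K" using a KD(2,6,7) by (auto simp: u_def v_def)
  \<comment> \<open>Read off from \<open>(1 + u) * (1 + v) = 1\<close>.\<close>
  have "v = - u + - (u * v)" using a by (simp add: u_def v_def algebra_simps)
  obtain k where k: "k < d" "\<forall>i<d. \<exists>r\<in>R. co v i = co v k * r"
    using valuation_ring_largest[OF R d_pos, of "co v"] by blast
  \<comment> \<open>\<open>\<nu>\<close> measures the size of \<open>v\<close> by its dominant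
    coordinate; \<open>l\<close> is divided out because the lattices carry that factor.\<close>
  define \<nu> where "\<nu> = co v k / l"
  have v\<nu>: "v \<in> scaled_lattice \<nu>" using k uv l0 by (simp add: scaled_lattice_def \<nu>_def)
  have "u * v \<in> scaled_lattice (\<pi> * \<nu>)" using lattice_mult v\<nu> a(3) by (simp add: u_def)
  then obtain r2 where r2: "r2 \<in> R" "co (u * v) k = \<pi> * \<nu> * l * r2"
    using k(1) by (auto simp: scaled_lattice_def)
  obtain r1 where r1: "r1 \<in> R" "co u k = \<pi> * l * r1"
    using a(3) k(1) by (auto simp: scaled_lattice_def u_def)
  obtain r where r: "r \<in> R" "\<pi> = s * r" using \<pi> by blast
  have "co v k = - co u k - co (u * v) k"
    using arg_cong[OF \<open>v = - u + - (u * v)\<close>, of "\<lambda>v. co v k"]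
      co_add[of "- u" "- (u * v)" k] co_uminus[of _ k] uv KD(4,5) k(1) by simp
  then have "\<nu> * l = - (\<pi> * l * r1) - \<pi> * \<nu> * l * r2" using r1 r2 l0 by (simp add: \<nu>_def)
  then have "l * (\<nu> * (1 + s * (r * r2))) = l * (\<pi> * (- r1))" by (simp add: r algebra_simps)
  then have "\<nu> * (1 + s * (r * r2)) = \<pi> * (- r1)" by (rule mult_left_cancel[OF l0, THEN iffD1])
  \<comment> \<open>As \<open>\<pi>\<close> is a multiple of \<open>s\<close>, the factor of
    \<open>\<nu>\<close> is a unit of \<open>R\<close>, so \<open>\<nu>\<close> is an
    \<open>R\<close>-multiple of \<open>\<pi>\<close>.\<close>
  moreover have unit: "1 + s * (r * r2) \<noteq> 0" "inverse (1 + s * (r * r2)) \<in> R"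
    using unit_1_plus RD(6) r r2 by auto
  ultimately have "\<nu> = \<pi> * (- r1 * inverse (1 + s * (r * r2)))" by (simp add: field_simps)
  moreover have "- r1 * inverse (1 + s * (r * r2)) \<in> R" using RD(3,6) r1 unit by blast
  ultimately have "v \<in> scaled_lattice \<pi>" using lattice_mono v\<nu> by blast
  then show ?thesis by (simp only: v_def)
qed

text \<open>\<open>\<mu>\<close> clears the denominators of the matrix of conjugation by
  \<open>x\<close>, so one \<open>\<mu>\<close> serves every \<open>\<pi>\<close>.\<close>

lemma conj_continuous:
  assumes x: "x \<in> K"
  obtains \<mu> where "\<mu> \<in> R" "\<mu> \<noteq> 0" "\<And>\<pi> v. v \<in> scaled_lattice (\<pi> * \<mu>) \<Longrightarrow> x * v * inverse x \<in> scaled_lattice \<pi>"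
proof -
  define c where "c i k = co (x * e i * inverse x) k" for i k
  define S where "S = (\<lambda>(i, k). c i k) ` ({..<d} \<times> {..<d})"
  have "finite S" by (simp add: S_def)
  then obtain \<mu> where \<mu>: "\<mu> \<in> R" "\<mu> \<noteq> 0" "\<forall>c\<in>S. \<mu> * c \<in> R"
    using valuation_ring_denominator[OF R] by blast
  have "x * v * inverse x \<in> scaled_lattice \<pi>" if v: "v \<in> scaled_lattice (\<pi> * \<mu>)" for \<pi> v
  proof -
    have vK: "v \<in> K" using v by (simp add: scaled_lattice_def)
    have "\<forall>i. \<exists>r. i < d \<longrightarrow> r \<in> R \<and> co v i = \<pi> * \<mu> * l * r" using v by (auto simp: scaled_lattice_def)
    then obtain r where r: "\<And>i. i < d \<Longrightarrow> r i \<in> R \<and> co v i = \<pi> * \<mu> * l * r i" by metis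
    have "x * v * inverse x = x * (\<Sum>i<d. \<iota> (co v i) * e i) * inverse x" using expand[OF vK] by simp
    also have "\<dots> = (\<Sum>i<d. \<iota> (co v i) * (x * e i * inverse x))"
      unfolding sum_distrib_left sum_distrib_right
    proof (rule sum.cong)
      fix i
      have "x * (\<iota> (co v i) * e i) * inverse x = (x * \<iota> (co v i)) * e i * inverse x"
        by (simp add: mult.assoc)
      also have "\<dots> = \<iota> (co v i) * (x * e i * inverse x)"
        by (simp add: iota_commute[OF x, symmetric] mult.assoc)
      finally show "x * (\<iota> (co v i) * e i) * inverse x = \<iota> (co v i) * (x * e i * inverse x)" .
    qed simp
    finally have co: "co (x * v * inverse x) k = (\<Sum>i<d. co v i * c i k)" if "k < d" for k
      using co_linear[of "{..<d}" "\<lambda>i. x * e i * inverse x" k "co v"] that x basis_in KD(4,6)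
      by (simp add: c_def)
    have "\<exists>t\<in>R. co (x * v * inverse x) k = \<pi> * l * t" if k: "k < d" for k
    proof
      have \<mu>c: "\<mu> * c i k \<in> R" if "i < d" for i
        using \<mu>(3) that k unfolding S_def by (metis (no_types, lifting) SigmaI case_prod_conv image_eqI lessThan_iff)
      show "(\<Sum>i<d. r i * (\<mu> * c i k)) \<in> R" by (intro RD(8) RD(6)[OF _ \<mu>c]) (use r in auto)
      show "co (x * v * inverse x) k = \<pi> * l * (\<Sum>i<d. r i * (\<mu> * c i k))"
        unfolding co[OF k] sum_distrib_left using r by (intro sum.cong) (auto simp: mult_ac)
    qed
    then show ?thesis using x vK KD(4,6) by (simp add: scaled_lattice_def)
  qed
  then show ?thesis using that \<mu> by blast
qed

lemma commutator_near_1: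
  assumes \<pi>: "\<pi> \<noteq> 0" "\<exists>r\<in>R. \<pi> = s * r" and x: "x \<in> K" "x \<noteq> 0"
  obtains \<rho> where "\<rho> \<noteq> 0"
    "\<And>a. a \<in> K \<Longrightarrow> a \<noteq> 0 \<Longrightarrow> a - 1 \<in> scaled_lattice \<rho> \<Longrightarrow> a * x * inverse a * inverse x - 1 \<in> scaled_lattice \<pi>"
proof -
  obtain \<mu> where \<mu>: "\<mu> \<in> R" "\<mu> \<noteq> 0" "\<And>\<pi> v. v \<in> scaled_lattice (\<pi> * \<mu>) \<Longrightarrow> x * v * inverse x \<in> scaled_lattice \<pi>"
    using conj_continuous[OF x(1)] by blast
  have \<pi>R: "\<pi> \<in> R" using \<pi>(2) s RD(6) by auto
  have \<rho>: "\<exists>r\<in>R. \<pi> * \<mu> = s * r" using \<pi>(2) \<mu>(1) RD(6) by (metis mult.assoc)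
  have "a * x * inverse a * inverse x - 1 \<in> scaled_lattice \<pi>"
    if a: "a \<in> K" "a \<noteq> 0" "a - 1 \<in> scaled_lattice (\<pi> * \<mu>)" for a
  proof -
    \<comment> \<open>The commutator factors as \<open>(1 + u) * (1 + v)\<close> with
      \<open>v\<close> the conjugate by \<open>x\<close> of \<open>inverse a - 1\<close>, and both
      \<open>u\<close> and \<open>v\<close> are small.\<close>
    define u v where "u = a - 1" and "v = x * (inverse a - 1) * inverse x"
    have u: "u \<in> scaled_lattice \<pi>" using a(3) lattice_mono[OF \<mu>(1)] by (auto simp: u_def)
    have v: "v \<in> scaled_lattice \<pi>" using \<mu>(3) inverse_near_1[OF \<rho> a] by (simp add: v_def)
    have "v = x * inverse a * inverse x - 1" using x(2) by (simp add: v_def algebra_simps)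
    then have "a * x * inverse a * inverse x = (u + 1) * (v + 1)" by (simp add: u_def mult.assoc)
    then have "a * x * inverse a * inverse x - 1 = u * v + u + v" by (simp add: algebra_simps)
    then show ?thesis using u v lattice_add lattice_mult_self[OF \<pi>R] by simp
  qed
  then show ?thesis using that[of "\<pi> * \<mu>"] \<pi>(1) \<mu>(2) by simp
qed

section \<open>Ascent along the subnormal chain\<close>

lemma radical_subnormal_central:
  assumes N: "subnormal N" "radical_over N center"
  shows "N \<inter> K \<subseteq> center_of K"
proof -
  obtain \<pi>1 where \<pi>1: "\<pi>1 \<noteq> 0" "\<exists>r\<in>R. \<pi>1 = s * r"
    and tor: "\<And>z. z \<in> K \<Longrightarrow> z - 1 \<in> scaled_lattice \<pi>1 \<Longrightarrow> \<exists>n>0. z ^ n = 1 \<Longrightarrow> z = 1"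
    using torsion_near_1 by blast
  \<comment> \<open>The property that climbs the chain. The neighbourhood may depend on
    \<open>x\<close>, while \<open>x\<close> always ranges over \<open>N\<close>, whatever
    \<open>G\<close> is.\<close>
  define P where "P G \<longleftrightarrow> (\<forall>x\<in>N \<inter> K. \<exists>\<pi>. \<pi> \<noteq> 0 \<and>
    (\<forall>a\<in>G \<inter> K. a - 1 \<in> scaled_lattice \<pi> \<longrightarrow> a * x = x * a))" for G
  have subgroup: "mult_subgroup N" by (rule mult_subgroup_if_subnormal[OF N(1)])
  have commute: "a * x = x * a"
    if "a * x * inverse a * inverse x = 1" "a \<noteq> 0" "x \<noteq> 0" for a x :: 'a
  proof -
    have "a * x = (a * x * inverse a * inverse x) * (x * a)" using that(2,3) by (simp add: mult.assoc)
      (simp add: mult.assoc[symmetric])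
    then show ?thesis using that(1) by simp
  qed
  have "P N"
    unfolding P_def
  proof
    fix x assume "x \<in> N \<inter> K"
    then have x: "x \<in> N" "x \<in> K" "x \<noteq> 0" using subgroup by (auto simp: mult_subgroup_def)
    obtain \<rho> where \<rho>: "\<rho> \<noteq> 0" "\<And>a. a \<in> K \<Longrightarrow> a \<noteq> 0 \<Longrightarrow> a - 1 \<in> scaled_lattice \<rho>
        \<Longrightarrow> a * x * inverse a * inverse x - 1 \<in> scaled_lattice \<pi>1"
      using commutator_near_1[OF \<pi>1 x(2,3)] by blast
    have "a * x = x * a" if a: "a \<in> N" "a \<in> K" "a - 1 \<in> scaled_lattice \<rho>" for a
    proof -
      have a0: "a \<noteq> 0" using a subgroup by (auto simp: mult_subgroup_def)
      define z where "z = a * x * inverse a * inverse x"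
      have "z \<in> N" using subgroup x a by (simp add: z_def mult_subgroup_def)
      then obtain k where k: "k > 0" "z ^ k \<in> center" using N(2) by (auto simp: radical_over_def)
      have zK: "z \<in> K" using x a KD(4,6) by (simp add: z_def)
      have "z ^ k \<in> center_of K" using k(2) KD(8)[OF zK] by (simp add: center_of_def)
      then have "\<exists>n>0. z ^ n = 1" using commutator_torsion[OF a(2) a0 x(2,3) z_def k(1)] by blast
      then have "z = 1" using tor[OF zK] \<rho>(2)[OF a(2) a0 a(3)] by (simp add: z_def)
      then show ?thesis using commute[OF _ a0 x(3)] unfolding z_def by blast
    qed
    then show "\<exists>\<pi>. \<pi> \<noteq> 0 \<and> (\<forall>a\<in>N \<inter> K. a - 1 \<in> scaled_lattice \<pi> \<longrightarrow> a * x = x * a)"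
      using \<rho>(1) by blast
  qed
  have up: "P H" if nrm: "normal_in G H" and NG: "N \<subseteq> G" and PG: "P G" for G H
    unfolding P_def
  proof
    fix x assume xN: "x \<in> N \<inter> K"
    then have x: "x \<in> N" "x \<in> G" "x \<in> K" "x \<noteq> 0"
      using subgroup NG by (auto simp: mult_subgroup_def)
    obtain \<pi> where \<pi>: "\<pi> \<noteq> 0" "\<forall>a\<in>G \<inter> K. a - 1 \<in> scaled_lattice \<pi> \<longrightarrow> a * x = x * a"
      using PG xN unfolding P_def by blast
    \<comment> \<open>Below \<open>\<pi>\<close> the commutator commutes with \<open>x\<close>, and
      below \<open>\<pi>1\<close> it cannot be a nontrivial torsion element; being a multiple of
      \<open>s\<close> is what continuity of the commutator demands.\<close>
    obtain \<sigma> where \<sigma>: "\<sigma> \<noteq> 0" "\<forall>a\<in>{\<pi>, \<pi>1, s}. \<exists>r\<in>R. \<sigma> = a * r"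
      using valuation_ring_common_multiple[OF R, of "{\<pi>, \<pi>1, s}"] \<pi>(1) \<pi>1(1) s0 by auto
    have "scaled_lattice \<sigma> \<subseteq> scaled_lattice a" if "\<exists>r\<in>R. \<sigma> = a * r" for a
      using that lattice_mono by blast
    then have sub: "scaled_lattice \<sigma> \<subseteq> scaled_lattice \<pi>" "scaled_lattice \<sigma> \<subseteq> scaled_lattice \<pi>1"
      using \<sigma>(2) by simp_all
    have \<sigma>s: "\<exists>r\<in>R. \<sigma> = s * r" using \<sigma>(2) by simp
    obtain \<rho> where \<rho>: "\<rho> \<noteq> 0" "\<And>a. a \<in> K \<Longrightarrow> a \<noteq> 0 \<Longrightarrow> a - 1 \<in> scaled_lattice \<rho>
        \<Longrightarrow> a * x * inverse a * inverse x - 1 \<in> scaled_lattice \<sigma>"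
      using commutator_near_1[OF \<sigma>(1) \<sigma>s x(3,4)] by blast
    have "a * x = x * a" if a: "a \<in> H" "a \<in> K" "a - 1 \<in> scaled_lattice \<rho>" for a
    proof -
      have a0: "a \<noteq> 0" using a nrm by (auto simp: mult_subgroup_def normal_in_def)
      define z where "z = a * x * inverse a * inverse x"
      have zK: "z \<in> K" using x a KD(4,6) by (simp add: z_def)
      have zG: "z \<in> G" using nrm x a by (simp add: z_def mult_subgroup_def normal_in_def)
      have z\<sigma>: "z - 1 \<in> scaled_lattice \<sigma>" using \<rho>(2)[OF a(2) a0 a(3)] by (simp add: z_def)
      then have zx: "z * x = x * z" using \<pi>(2) zG zK sub by blast
      obtain m where m: "m > 0" "x ^ m \<in> center" using N(2) x by (auto simp: radical_over_def)
      have "z * x = a * x * inverse a" using x by (simp add: z_def mult.assoc)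
      then have "z ^ m * x ^ m = a * x ^ m * inverse a"
        using conj_power[OF a0, of x m] power_commute_mult[OF zx, of m] by simp
      also have "\<dots> = x ^ m * a * inverse a" using center_ofD[OF m(2), of a] by simp
      also have "\<dots> = 1 * x ^ m" using a0 by (simp add: mult.assoc)
      finally have "z ^ m = 1" using x by simp
      then have "z = 1" using tor[OF zK] z\<sigma> sub m(1) by blast
      then show ?thesis using commute[OF _ a0 x(4)] unfolding z_def by blast
    qed
    then show "\<exists>\<pi>. \<pi> \<noteq> 0 \<and> (\<forall>a\<in>H \<inter> K. a - 1 \<in> scaled_lattice \<pi> \<longrightarrow> a * x = x * a)"
      using \<rho>(1) by blast
  qed
  \<comment> \<open>The induction builds the chain downwards from the full group, but
    \<open>P G\<close> is a premise: one step transfers it from \<open>G\<close> to the larger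
    group, and the induction hypothesis carries it to the top.\<close>
  have "P {x. x \<noteq> 0}" if "subnormal G" "N \<subseteq> G" "P G" for G
    using that
  proof (induction rule: subnormal.induct)
    case (step H G)
    then show ?case using up[OF step.hyps(2)] by (auto simp: normal_in_def)
  qed
  then have top: "P {x. x \<noteq> 0}" using N(1) \<open>P N\<close> by blast
  show ?thesis
  proof
    fix x assume x: "x \<in> N \<inter> K"
    obtain \<pi> where \<pi>: "\<pi> \<noteq> 0" "\<And>a. a \<noteq> 0 \<Longrightarrow> a \<in> K \<Longrightarrow> a - 1 \<in> scaled_lattice \<pi> \<Longrightarrow> a * x = x * a"
      using top x unfolding P_def by blast
    have "x * w = w * x" if w: "w \<in> K" for w
    proof -
      obtain t where t: "t \<in> R" "t \<noteq> 0" "\<forall>c\<in>co w ` {..<d}. t * c \<in> R"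
        using valuation_ring_denominator[OF R, of "co w ` {..<d}"] by auto
      \<comment> \<open>A nonzero central factor shrinking \<open>w\<close> into the neighbourhood:
        \<open>1 + \<iota> f * w\<close> commutes with \<open>x\<close>, and then \<open>f\<close>
        cancels.\<close>
      define f where "f = \<pi> * l * t"
      have f0: "f \<noteq> 0" using \<pi> l0 t by (simp add: f_def)
      have fw: "\<iota> f * w \<in> scaled_lattice \<pi>"
        using t w KD(4) iota_in unfolding scaled_lattice_def
        by (auto simp: co_scale f_def mult.assoc intro!: bexI[of _ "t * co w _"])
      define a where "a = \<iota> f * w + 1"
      have "a \<in> K" using w KD(2,3,4) iota_in by (simp add: a_def)
      \<comment> \<open>The value \<open>a = 0\<close> lies outside the multiplicative group but
        commutes with \<open>x\<close> anyway.\<close>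
      then have "a * x = x * a" using \<pi>(2)[of a] fw by (cases "a = 0") (auto simp: a_def)
      then have "\<iota> f * w * x = x * \<iota> f * w" by (simp add: a_def algebra_simps)
      also have "x * \<iota> f = \<iota> f * x" using iota_commute x by auto
      finally have "\<iota> f * (w * x) = \<iota> f * (x * w)" by (simp add: mult.assoc)
      then show ?thesis using f0 iota_eq_0 by auto
    qed
    then show "x \<in> center_of K" using x by (auto simp: center_of_def)
  qed
qed

end

section \<open>The choice between the locally finite and the valued case\<close>

context centrally_finite
begin

theorem subnormal_radical_central:
  assumes N: "subnormal N" "radical_over N center"
  shows "N \<inter> K \<subseteq> center_of K"
proof (cases "\<forall>s::'f. s \<noteq> 0 \<longrightarrow> inverse s \<in> adjoin (range of_int) s")
  case True
  then show ?thesis using locally_finite_center_commute by (auto simp: center_of_def)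
next
  case False
  then obtain s :: 'f where "inverse s \<notin> adjoin (range of_int) s" by blast
  then obtain R where R: "valuation_ring R" "s \<in> R" "inverse s \<notin> R"
    using valuation_ring_exists by blast
  let ?S = "(\<lambda>(i, j, k). co (e i * e j) k) ` ({..<d} \<times> {..<d} \<times> {..<d})"
  obtain l where l: "l \<in> R" "l \<noteq> 0" "\<forall>c\<in>?S. l * c \<in> R"
    using valuation_ring_denominator[OF R(1), of ?S] by auto
  have "co (e i * e j) k \<in> ?S" if "i < d" "j < d" "k < d" for i j k
    using that by (intro image_eqI[of _ _ "(i, j, k)"]) auto
  then interpret centrally_finite_valued K \<iota> d e co R s l
    using R l by unfold_locales auto
  show ?thesis by (rule radical_subnormal_central[OF N])
qed

end

section \<open>The center as a type\<close>

text \<open>Determinants need the center as a type. A type cannot depend on a local set, so it is built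
  from one globally chosen finite set \<open>S\<close>: a counterexample, if there is any.\<close>

definition exceptional_set :: "'a::division_ring set" where
  "exceptional_set = (SOME S. finite S \<and> (\<exists>N. subnormal N \<and> radical_over N center \<and>
     \<not> N \<inter> gen_division_subring S \<subseteq> center_of (gen_division_subring S)))"

definition exceptional_subring :: "'a::division_ring set" where
  "exceptional_subring = gen_division_subring exceptional_set"

lemma division_subring_exceptional_center:
  "division_subring (center_of (exceptional_subring :: 'a::division_ring set))"
  unfolding exceptional_subring_def
  by (intro division_subring_center_of division_subring_gen)

lemmas exceptional_centerD = division_subringD[OF division_subring_exceptional_center]

typedef (overloaded) 'a exceptional_center = "center_of (exceptional_subring :: 'a::division_ring set)"
  morphisms rep_center abs_center
  using exceptional_centerD(1) by blast

setup_lifting type_definition_exceptional_center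

instantiation exceptional_center :: (division_ring) field
begin

lift_definition zero_exceptional_center :: "'a exceptional_center" is 0
  by (rule exceptional_centerD(1))
lift_definition one_exceptional_center :: "'a exceptional_center" is 1
  by (rule exceptional_centerD(2))
lift_definition plus_exceptional_center ::
  "'a exceptional_center \<Rightarrow> 'a exceptional_center \<Rightarrow> 'a exceptional_center" is "(+)"
  by (rule exceptional_centerD(3))
lift_definition times_exceptional_center ::
  "'a exceptional_center \<Rightarrow> 'a exceptional_center \<Rightarrow> 'a exceptional_center" is "(*)"
  by (rule exceptional_centerD(4))
lift_definition uminus_exceptional_center :: "'a exceptional_center \<Rightarrow> 'a exceptional_center"
  is uminus by (rule exceptional_centerD(5))
lift_definition inverse_exceptional_center :: "'a exceptional_center \<Rightarrow> 'a exceptional_center"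
  is inverse by (rule exceptional_centerD(6))
lift_definition minus_exceptional_center ::
  "'a exceptional_center \<Rightarrow> 'a exceptional_center \<Rightarrow> 'a exceptional_center" is "(-)"
  by (rule exceptional_centerD(7))
definition divide_exceptional_center ::
  "'a exceptional_center \<Rightarrow> 'a exceptional_center \<Rightarrow> 'a exceptional_center"
  where "divide_exceptional_center x y = x * inverse y"

instance
proof
  fix a b c :: "'a exceptional_center"
  show "a * b = b * a"
    by transfer (meson center_ofD center_of_subset subsetD)
  show "a \<noteq> 0 \<Longrightarrow> inverse a * a = 1" by transfer simp
  show "a * b * c = a * (b * c)" by transfer (simp add: mult.assoc)
  show "(a + b) * c = a * c + b * c" by transfer (simp add: distrib_right)
  show "a + b + c = a + (b + c)" by transfer (simp add: add.assoc)
  show "a + b = b + a" by transfer (simp add: add.commute)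
  show "1 * a = a" "0 + a = a" "- a + a = 0" "a - b = a + - b" by (transfer, simp)+
  show "(0::'a exceptional_center) \<noteq> 1" by transfer simp
  show "inverse (0::'a exceptional_center) = 0" by transfer simp
  show "a div b = a * inverse b" by (rule divide_exceptional_center_def)
qed

end

lemma exceptional_subring_central:
  assumes fd: "fin_dim_over_center (exceptional_subring :: 'a::division_ring set)"
    and N: "subnormal (N :: 'a set)" "radical_over N center"
  shows "N \<inter> exceptional_subring \<subseteq> center_of exceptional_subring"
proof -
  let ?K = "exceptional_subring :: 'a set"
  have K: "division_subring ?K" unfolding exceptional_subring_def by (rule division_subring_gen)
  let ?scale = "\<lambda>(f :: 'a exceptional_center) (v :: 'a). rep_center f * v"
  \<comment> \<open>The whole division ring is a left vector space over the center of
    \<open>?K\<close>, so \<open>?K\<close> needs no type of its own.\<close>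
  interpret vs: vector_space ?scale
    by unfold_locales
      (simp_all add: distrib_left distrib_right mult.assoc plus_exceptional_center.rep_eq
        times_exceptional_center.rep_eq one_exceptional_center.rep_eq)
  obtain B where B: "finite B" "B \<subseteq> ?K"
    "\<forall>x\<in>?K. \<exists>c. (\<forall>b\<in>B. c b \<in> center_of ?K) \<and> x = (\<Sum>b\<in>B. c b * b)"
    using fd unfolding fin_dim_over_center_def by blast
  have KB: "?K \<subseteq> vs.span B"
  proof
    fix x assume "x \<in> ?K"
    then obtain c where c: "\<forall>b\<in>B. c b \<in> center_of ?K" "x = (\<Sum>b\<in>B. c b * b)" using B(3) by blast
    have "x = (\<Sum>b\<in>B. rep_center (abs_center (c b)) * b)"
      unfolding c(2) using c(1) by (intro sum.cong) (simp_all add: abs_center_inverse)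
    also have "\<dots> \<in> vs.span B" by (intro vs.span_sum vs.span_scale vs.span_base)
    finally show "x \<in> vs.span B" .
  qed
  \<comment> \<open>The finite spanning set is thinned out to a basis; as a subset of
    \<open>B\<close> it stays inside \<open>?K\<close>.\<close>
  obtain C where C: "C \<subseteq> B" "vs.independent C" "B \<subseteq> vs.span C"
    using vs.maximal_independent_subset[of B] by blast
  have fC: "finite C" using C(1) B(1) finite_subset by blast
  have KC: "?K \<subseteq> vs.span C" using KB C(3) vs.span_mono vs.span_span by blast
  define d where "d = card C"
  obtain e where e: "bij_betw e {..<d} C"
    using ex_bij_betw_nat_finite[OF fC] by (auto simp: d_def lessThan_atLeast0)
  have eC: "e i \<in> C" if "i < d" for i using e that by (auto simp: bij_betw_def)
  interpret centrally_finite ?K rep_center d e "\<lambda>v i. vs.representation C v (e i)"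
  proof
    show "division_subring ?K" by (rule K)
    show "rep_center (x + y) = rep_center x + rep_center y" for x y :: "'a exceptional_center"
      by (rule plus_exceptional_center.rep_eq)
    show "rep_center (x * y) = rep_center x * rep_center y" for x y :: "'a exceptional_center"
      by (rule times_exceptional_center.rep_eq)
    show "rep_center (1 :: 'a exceptional_center) = 1" by (rule one_exceptional_center.rep_eq)
    show "range rep_center = center_of ?K"
      by (rule type_definition.Rep_range[OF type_definition_exceptional_center])
    show "e i \<in> ?K" if "i < d" for i using eC[OF that] C(1) B(2) by auto
    show "v = (\<Sum>i<d. rep_center (vs.representation C v (e i)) * e i)" if "v \<in> ?K" for v
    proof -
      have "v = (\<Sum>b\<in>C. rep_center (vs.representation C v b) * b)"
        using vs.sum_representation_eq[OF C(2) _ fC, of v] that KC by auto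
      also have "\<dots> = (\<Sum>i<d. rep_center (vs.representation C v (e i)) * e i)"
        by (rule sum.reindex_bij_betw[OF e, symmetric])
      finally show ?thesis .
    qed
    show "vs.representation C (\<Sum>j<d. rep_center (c j) * e j) (e i) = c i" if i: "i < d"
      for i and c :: "nat \<Rightarrow> 'a exceptional_center"
    proof -
      have sp: "e j \<in> vs.span C" if "j < d" for j using eC[OF that] vs.span_base by blast
      have "vs.representation C (\<Sum>j<d. rep_center (c j) * e j) (e i)
          = (\<Sum>j<d. vs.representation C (rep_center (c j) * e j) (e i))"
        using sp by (subst vs.representation_sum[OF C(2)]) (auto intro: vs.span_scale)
      also have "\<dots> = (\<Sum>j<d. if j = i then c j else 0)"
      proof (rule sum.cong)
        fix j assume "j \<in> {..<d}"
        then have j: "j < d" by simp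
        have "e i = e j \<longleftrightarrow> j = i" using e i j by (auto simp: bij_betw_def inj_on_def)
        then show "vs.representation C (rep_center (c j) * e j) (e i) = (if j = i then c j else 0)"
          using vs.representation_scale[OF C(2) sp[OF j], of "c j"]
            vs.representation_basis[OF C(2) eC[OF j]] by simp
      qed simp
      finally show ?thesis using i by simp
    qed
  qed
  show ?thesis by (rule subnormal_radical_central[OF N])
qed

theorem theorem6p4:
  fixes N :: "'a::division_ring set"
  assumes "weakly_locally_finite TYPE('a)"
    and "subnormal N"
    and "radical_over N center"
  shows "N \<subseteq> center"
proof
  fix x assume x: "x \<in> N"
  have "x * y = y * x" for y
  proof (rule ccontr)
    assume xy: "x * y \<noteq> y * x"
    let ?P = "\<lambda>S :: 'a set. finite S \<and> (\<exists>N. subnormal N \<and> radical_over N center \<and>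
      \<not> N \<inter> gen_division_subring S \<subseteq> center_of (gen_division_subring S))"
    have xyS: "x \<in> gen_division_subring {x, y}" "y \<in> gen_division_subring {x, y}"
      using gen_division_subring_superset[of "{x, y}"] by auto
    then have "x \<notin> center_of (gen_division_subring {x, y})"
      using center_ofD xy by blast
    then have "?P {x, y}" using assms(2,3) x xyS by blast
    \<comment> \<open>The set \<open>{x, y}\<close> shows that counterexamples exist, so the
      globally chosen set is one too, though possibly a different one; its division subring
      contradicts the result just proved.\<close>
    then have "?P exceptional_set" unfolding exceptional_set_def by (rule someI)
    then show False
      using exceptional_subring_central assms(1)
      unfolding weakly_locally_finite_def exceptional_subring_def by blast
  qed
  then show "x \<in> center" by (simp add: center_of_def)
qed

end
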